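(* Let $\omega$ be a modulus of continuity for which there exist constants $C',C''$ such that for all $x>0$ $$\int_{0}^{x}\frac{\omega (t)}{t}\, dt \le C' \omega (x),\qquad x\int_{x}^{\infty}\frac{\omega (t)}{t^2}\, dt\le C'' \omega (x).$$ Let $L\subset\mathbb{R}^3$ be a bounded non-closed chord-arc curve and let $f\in H^{\omega}(L)$. Then there exist constants $C_1=C_1(f,L)$ and $C_2=C_2(f,L)$ such that for every $\delta>0$ there exists a function $\upsilon_\delta$ harmonic in $\Omega_\delta(L)$ such that $$|\upsilon_\delta(M)-f(M)|\le C_1\,\omega(\delta)\quad\text{for all } M\in L,$$ $$|\nabla \upsilon_\delta(M)|\le C_2\,\frac{\omega(\delta)}{\delta}\quad\text{for all } M\in \Omega_{\delta}(L)\setminus\Omega_{\delta/2}(L).$$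
   Context: A modulus of continuity is a continuous, nondecreasing, subadditive function $\omega:[0,\infty)\to[0,\infty)$ with $\omega(0)=0$ and $\omega(t)>0$ for $t>0$. A bounded non-closed Jordan curve $L\subset\mathbb{R}^3$ is a Jordan arc with two distinct endpoints, i.e. a homeomorphic image of $[0,1]$. It is a chord-arc curve if there is a constant $C=C(L)$ such that for all $M_1,M_2\in L$ the length of the subarc of $L$ between $M_1$ and $M_2$ does not exceed $C\|M_1M_2\|$, where $\|M_1M_2\|$ is the Euclidean distance in $\mathbb{R}^3$. $B_r(M)$ is the open ball in $\mathbb{R}^3$ with center $M$ and radius $r$, and $\Omega_\delta(L)=\bigcup_{M\in L}B_\delta(M)$. $H^\omega(L)$ is the space of all complex-valued functions $f$ on $L$ for which there is a constant $C_f$ with $|f(M_2)-f(M_1)|\le C_f\,\omega(\|M_1M_2\|)$ for all $M_1,M_2\in L$. Harmonic functions are complex-valued. *)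

theory Defs
  imports "HOL-Analysis.Analysis"
begin

(* A function on [0,\<infinity>) is a total function on the reals of which only the values
   on {0..} matter; \<omega> \<ge> 0 on {0..} follows from the first and the last condition. *)
definition modulus_of_continuity :: "(real \<Rightarrow> real) \<Rightarrow> bool" where
  "modulus_of_continuity \<omega> \<longleftrightarrow>
     \<omega> 0 = 0 \<and> continuous_on {0..} \<omega> \<and> mono_on {0..} \<omega> \<and>
     (\<forall>s\<ge>0. \<forall>t\<ge>0. \<omega> (s + t) \<le> \<omega> s + \<omega> t) \<and>
     (\<forall>t>0. 0 < \<omega> t)"

(* Supremum of the lengths of inscribed polygonal lines; \<infinity> for non-rectifiable paths. *)
definition path_length :: "(real \<Rightarrow> 'a::metric_space) \<Rightarrow> ennreal" where
  "path_length g = (SUP ts \<in> {ts. sorted ts \<and> set ts \<subseteq> {0..1}}.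
     \<Sum>k<length ts - 1. ennreal (dist (g (ts ! k)) (g (ts ! Suc k))))"

(* An arc g of the library is injective, so path_image (subpath s t g) is the subarc
   of the curve between the points g s and g t. *)
definition chord_arc_curve :: "'a::real_normed_vector set \<Rightarrow> bool" where
  "chord_arc_curve L \<longleftrightarrow> (\<exists>g. arc g \<and> path_image g = L \<and>
     (\<exists>C. \<forall>s\<in>{0..1}. \<forall>t\<in>{0..1}.
        path_length (subpath s t g) \<le> ennreal (C * dist (g s) (g t))))"

definition tube :: "real \<Rightarrow> 'a::metric_space set \<Rightarrow> 'a set" where
  "tube \<delta> L = (\<Union>M\<in>L. ball M \<delta>)"

(* Only the values on L are constrained. *)
definition hoelder_class :: "(real \<Rightarrow> real) \<Rightarrow> 'a::metric_space set \<Rightarrow> ('a \<Rightarrow> complex) set" where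
  "hoelder_class \<omega> L =
     {f. \<exists>C. \<forall>M1\<in>L. \<forall>M2\<in>L. cmod (f M2 - f M1) \<le> C * \<omega> (dist M1 M2)}"

definition partial_derivative :: "'n::finite \<Rightarrow> (real^'n \<Rightarrow> complex) \<Rightarrow> real^'n \<Rightarrow> complex" where
  "partial_derivative i u x = frechet_derivative u (at x) (axis i 1)"

(* The norm on complex^'n is the Hermitian one, so norm (gradient u x) is the square root
   of the sum of the squared moduli of the partial derivatives. *)
definition gradient :: "(real^'n::finite \<Rightarrow> complex) \<Rightarrow> real^'n \<Rightarrow> complex^'n" where
  "gradient u x = (\<chi> i. partial_derivative i u x)"

definition laplacian :: "(real^'n::finite \<Rightarrow> complex) \<Rightarrow> real^'n \<Rightarrow> complex" where
  "laplacian u x = (\<Sum>i\<in>UNIV. partial_derivative i (partial_derivative i u) x)"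

(* The differentiability conditions make the frechet_derivative terms meaningful. *)
definition twice_continuously_differentiable_on ::
    "(real^'n::finite \<Rightarrow> complex) \<Rightarrow> (real^'n) set \<Rightarrow> bool" where
  "twice_continuously_differentiable_on u S \<longleftrightarrow>
     (\<forall>x\<in>S. u differentiable (at x)) \<and>
     (\<forall>i. \<forall>x\<in>S. partial_derivative i u differentiable (at x)) \<and>
     (\<forall>i j. continuous_on S (partial_derivative j (partial_derivative i u)))"

definition harmonic_on :: "(real^'n::finite \<Rightarrow> complex) \<Rightarrow> (real^'n) set \<Rightarrow> bool" where
  "harmonic_on u S \<longleftrightarrow>
     open S \<and> twice_continuously_differentiable_on u S \<and> (\<forall>x\<in>S. laplacian u x = 0)"

end

theory Submission
  imports Defs
begin

text \<open>
  Choose points $p_0, \ldots, p_N$ along the arc with consecutive distances \<open>\<delta>\<close>; the chord-arc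
  condition makes $|p_i - p_j|$ comparable to $\delta |i - j|$. The approximant is
  $f(p_0) + \sum_i (f(p_i) - f(p_{i-1})) H_i$, where $H_i$ is a harmonic substitute for the step
  function that is 0 before $p_i$ and 1 after it: on the tube near $p_j$ its error is
  $O((1 + |i - j|)^{-2})$ and its gradient is $O(\delta^{-1} (1 + |i - j|)^{-2})$, which is summable in $i$.
  To construct $H_i$ (for \<open>\<delta> = 1\<close>), take a smooth cutoff \<open>\<chi>\<close> that is 1 around the points with index
  at least $i$. By Gauss' law \<open>\<chi>\<close> is the potential of the dipole density \<open>\<nabla>\<chi>\<close>. This density meets the
  tube only near $p_i$; deleting it there makes the potential harmonic in the tube, and the deleted
  compactly supported dipoles have a potential that decays quadratically.
\<close>

section \<open>Integrals of compactly supported continuous functions\<close>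

text \<open>The number of chain points grows as \<delta> shrinks, so the constants may depend on the
  chord-arc constant but never on N. An error of order 1 / (1 + |i - j|) would sum to log N; this is
  why dipoles are cut out and not charges, whose potential decays only to first order. The obstacle
  is that the density that is kept still stretches along the whole chain from i on, so estimating
  its potential directly shows no decay in |i - j|. Two estimates are therefore combined. For
  bounded |i - j| the direct one suffices, because the kernel at \<open>q j\<close> decays
  quadratically in |k - j|. For large |i - j| the full density vanishes near \<open>q j\<close>, and
  Gauss' law turns the kept potential into the exact step minus the potential of the deleted part,
  which sits near \<open>q i\<close>. This is an identity on a ball, so it may be differentiated;
  the step is constant there and drops out, which yields the gradient bound. Cutoffs of class C^1
  and a merely continuous deletion factor are smooth enough, because all further derivatives fall on
  the kernel.\<close>

lemma bounded_support_obtain_cbox: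
  fixes f :: "'a::euclidean_space \<Rightarrow> 'b::zero"
  assumes "bounded {y. f y \<noteq> 0}"
  obtains a b where "\<And>y. y \<notin> cbox a b \<Longrightarrow> f y = 0" "box a b \<noteq> {}"
proof -
  \<comment> \<open>Adding the point 0 makes the box nonempty even when the support is
    empty.\<close>
  obtain a where "{y. f y \<noteq> 0} \<union> {0} \<subseteq> box (- a) a"
    using bounded_subset_box_symmetric[of "{y. f y \<noteq> 0} \<union> {0}"] assms by auto
  then show ?thesis
    by (intro that[of "-a" a]) (use box_subset_cbox in fastforce)+
qed

lemma integral_UNIV_eq_cbox:
  fixes f :: "'a::euclidean_space \<Rightarrow> 'b::banach"
  assumes "\<And>y. y \<notin> cbox a b \<Longrightarrow> f y = 0"
  shows "integral UNIV f = integral (cbox a b) f"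
proof -
  have "(\<lambda>x. if x \<in> cbox a b then f x else 0) = f"
    using assms by auto
  then show ?thesis
    using integral_restrict_UNIV[of "cbox a b" f] by simp
qed

lemma integrable_on_UNIV_compact_support:
  fixes f :: "'a::euclidean_space \<Rightarrow> 'b::banach"
  assumes "continuous_on UNIV f" "bounded {y. f y \<noteq> 0}"
  shows "f integrable_on UNIV"
proof -
  obtain a b where ab: "\<And>y. y \<notin> cbox a b \<Longrightarrow> f y = 0"
    using bounded_support_obtain_cbox[OF assms(2)] by metis
  then have "(\<lambda>x. if x \<in> cbox a b then f x else 0) = f"
    by auto
  moreover have "f integrable_on cbox a b"
    using assms(1) continuous_on_subset integrable_continuous by blast
  ultimately show ?thesis
    using integrable_restrict_UNIV[of "cbox a b" f] by simp
qed

lemma integral_UNIV_translate: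
  fixes f :: "'a::euclidean_space \<Rightarrow> 'b::banach"
  assumes "bounded {y. f y \<noteq> 0}"
  shows "integral UNIV (\<lambda>y. f (y + c)) = integral UNIV f"
proof -
  obtain a b where ab: "\<And>y. y \<notin> cbox a b \<Longrightarrow> f y = 0"
    using bounded_support_obtain_cbox[OF assms] by metis
  have "f (y + c) = 0" if "y \<notin> cbox (a - c) (b - c)" for y
    using that by (intro ab) (auto simp: mem_box algebra_simps)
  then show ?thesis
    using integral_UNIV_eq_cbox[of a b f, OF ab]
      integral_UNIV_eq_cbox[of "a-c" "b-c" "\<lambda>y. f (y + c)"]
      integral_shift_cbox_plus[of "a-c" "b-c" f c] by (simp add: o_def add.commute)
qed

text \<open>This replaces the divergence theorem: by translation invariance the integral of
  \<open>g (y + s e)\<close> does not depend on s, and differentiating it under the integral sign at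
  s = 0 gives the claim.\<close>

lemma integral_directional_derivative_eq_0:
  fixes g :: "'a::euclidean_space \<Rightarrow> real"
  assumes g: "\<And>y. (g has_derivative (\<lambda>h. D y \<bullet> h)) (at y)"
    and D: "continuous_on UNIV D" and supp: "bounded {y. g y \<noteq> 0}"
  shows "integral UNIV (\<lambda>y. D y \<bullet> e) = 0"
proof -
  obtain B where B: "\<And>y. g y \<noteq> 0 \<Longrightarrow> norm y \<le> B"
    using supp unfolding bounded_iff by auto
  have D0: "D y = 0" if "norm y > B" for y
  proof -
    have "(g has_derivative (\<lambda>h. 0)) (at y within - cball 0 B)"
      by (rule has_derivative_transform[where f="\<lambda>_. 0"]) (use that B in \<open>auto simp: not_le[symmetric]\<close>)
    then have "(g has_derivative (\<lambda>h. 0)) (at y)"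
      using that by (subst (asm) at_within_open) auto
    from has_derivative_unique[OF g this] have "D y \<bullet> D y = 0"
      by metis
    then show ?thesis by simp
  qed
  \<comment> \<open>The margin \<open>norm e\<close> lets one box contain the supports of all
    translates with |s| \<le> 1.\<close>
  obtain c where c: "cball (0::'a) (\<bar>B\<bar> + norm e) \<subseteq> cbox (-c) c"
    using bounded_subset_cbox_symmetric[of "cball (0::'a) (\<bar>B\<bar> + norm e)"] by auto
  have contg: "continuous_on UNIV g"
    using g by (intro continuous_at_imp_continuous_on) (auto intro: has_derivative_continuous)
  have "((\<lambda>s::real. integral (cbox (-c) c) (\<lambda>y. g (y + s *\<^sub>R e)))
         has_vector_derivative integral (cbox (-c) c) (\<lambda>y. D (y + 0 *\<^sub>R e) \<bullet> e))
         (at 0 within {-1..1})"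
  proof (rule leibniz_rule_vector_derivative)
    show "((\<lambda>s. g (t + s *\<^sub>R e)) has_vector_derivative D (t + x *\<^sub>R e) \<bullet> e)
            (at x within {-1..1})" for x t
      unfolding has_vector_derivative_def
      by (rule has_derivative_eq_rhs, rule has_derivative_compose[OF _ g])
        (auto intro!: derivative_eq_intros)
    show "(\<lambda>y. g (y + x *\<^sub>R e)) integrable_on cbox (-c) c" for x
      by (intro integrable_continuous continuous_intros continuous_on_compose2[OF contg]) auto
    show "continuous_on ({- 1..1} \<times> cbox (- c) c) (\<lambda>(x, t). D (t + x *\<^sub>R e) \<bullet> e)"
      unfolding split_beta
      by (intro continuous_intros continuous_on_compose2[OF D]) auto
  qed auto
  note der = this
  have const: "integral UNIV g = integral (cbox (-c) c) (\<lambda>y. g (y + s *\<^sub>R e))"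
    if "s \<in> {-1..1}" for s
  proof -
    have "g (y + s *\<^sub>R e) = 0" if "y \<notin> cbox (-c) c" for y
    proof (rule ccontr)
      assume "g (y + s *\<^sub>R e) \<noteq> 0"
      then have "norm (y + s *\<^sub>R e) \<le> \<bar>B\<bar>" using B[of "y + s *\<^sub>R e"] by linarith
      moreover have "norm (s *\<^sub>R e) \<le> 1 * norm e"
        using \<open>s \<in> {-1..1}\<close> unfolding norm_scaleR by (intro mult_right_mono) auto
      ultimately have "norm y \<le> \<bar>B\<bar> + norm e"
        using norm_triangle_ineq4[of "y + s *\<^sub>R e" "s *\<^sub>R e"] by simp
      then show False using c that by (auto simp: subset_iff)
    qed
    then show ?thesis
      using integral_UNIV_eq_cbox[of "-c" c "\<lambda>y. g (y + s *\<^sub>R e)"]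
        integral_UNIV_translate[OF supp] by simp
  qed
  have "((\<lambda>s::real. integral UNIV g)
         has_vector_derivative integral (cbox (-c) c) (\<lambda>y. D (y + 0 *\<^sub>R e) \<bullet> e))
         (at 0 within {-1..1})"
    by (rule has_vector_derivative_transform[OF _ const der]) auto
  then have "((\<lambda>s::real. integral UNIV g)
         has_vector_derivative integral (cbox (-c) c) (\<lambda>y. D (y + 0 *\<^sub>R e) \<bullet> e)) (at 0)"
    using at_within_interior[of "0::real" "{-1..1}"] by (simp add: interior_atLeastAtMost_real)
  then have "integral (cbox (-c) c) (\<lambda>y. D y \<bullet> e) = 0"
    using vector_derivative_unique_at[OF _ has_vector_derivative_const] by fastforce
  moreover have "D y \<bullet> e = 0" if "y \<notin> cbox (-c) c" for y
  proof -
    have "\<not> norm y \<le> \<bar>B\<bar> + norm e"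
      using that c by (auto simp: subset_iff)
    then have "norm y > B"
      using norm_ge_zero[of e] by linarith
    then show ?thesis using D0 by simp
  qed
  ultimately show ?thesis
    using integral_UNIV_eq_cbox[of "-c" c "\<lambda>y. D y \<bullet> e"] by simp
qed

lemma integral_continuous_pos:
  fixes f :: "'a::euclidean_space \<Rightarrow> real"
  assumes "continuous_on UNIV f" "bounded {y. f y \<noteq> 0}" "\<And>y. 0 \<le> f y" "f x > 0"
  shows "integral UNIV f > 0"
proof -
  obtain a b where ab: "\<And>y. y \<notin> cbox a b \<Longrightarrow> f y = 0" "box a b \<noteq> {}"
    using bounded_support_obtain_cbox[OF assms(2)] by metis
  have cont: "continuous_on (cbox a b) f"
    using assms(1) continuous_on_subset by blast
  have "integral (cbox a b) f \<noteq> 0"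
  proof
    assume "integral (cbox a b) f = 0"
    then have "(f has_integral 0) (cbox a b)"
      using cont by (metis integrable_continuous integrable_integral)
    then have "f x = 0"
      using has_integral_0_cbox_imp_0[OF cont assms(3) _ ab(2)] ab(1) by blast
    then show False using assms(4) by simp
  qed
  moreover have "integral (cbox a b) f \<ge> 0"
    using cont assms(3) by (intro integral_nonneg integrable_continuous)
  ultimately show ?thesis
    using integral_UNIV_eq_cbox[of a b f, OF ab(1)] by simp
qed

section \<open>The field of a point charge and its derivatives\<close>

text \<open>Up to sign the gradient of the fundamental solution $1/|z|$ of the Laplacian on $R^3$.\<close>
definition charge_field :: "real^'n::finite \<Rightarrow> real^'n" where
  "charge_field z = inverse (norm z ^ 3) *\<^sub>R z"

text \<open>At 0 these formulas take the value 0, because \<open>inverse 0 = 0\<close>; the two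
  trace identities below therefore hold at every point.\<close>

definition charge_field_d1 :: "'n::finite \<Rightarrow> real^'n \<Rightarrow> real^'n" where
  "charge_field_d1 i z = inverse (norm z ^ 3) *\<^sub>R axis i 1 - (3 * z $ i * inverse (norm z ^ 5)) *\<^sub>R z"

definition charge_field_d2 :: "'n::finite \<Rightarrow> 'n \<Rightarrow> real^'n \<Rightarrow> real^'n" where
  "charge_field_d2 i j z =
     - (3 * z $ j * inverse (norm z ^ 5)) *\<^sub>R axis i 1
     - (3 * z $ i * inverse (norm z ^ 5)) *\<^sub>R axis j 1
     - (3 * (if i = j then 1 else 0) * inverse (norm z ^ 5)) *\<^sub>R z
     + (15 * z $ i * z $ j * inverse (norm z ^ 7)) *\<^sub>R z"

lemma inner_vec_eq_sum: "(x::real^'n) \<bullet> y = (\<Sum>i\<in>UNIV. x $ i * y $ i)"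
  by (simp add: inner_vec_def)

lemma has_derivative_inverse_norm_power:
  fixes z :: "'a::real_inner"
  assumes "z \<noteq> 0" "n > 0"
  shows "((\<lambda>z. inverse (norm z ^ n)) has_derivative
           (\<lambda>h. - (real n * inverse (norm z ^ (n + 2)) * (z \<bullet> h)))) (at z)"
proof -
  obtain m where n: "n = Suc m" using assms by (cases n) auto
  have "(norm has_derivative (\<lambda>h. h \<bullet> z / norm z)) (at z)"
    using has_derivative_norm[OF assms(1)]
    by (simp add: sgn_div_norm divide_inverse mult.commute)
  from Deriv.has_derivative_inverse[OF _ has_derivative_power[OF this, of n]] assms(1)
  have "((\<lambda>z. inverse (norm z ^ n)) has_derivative (\<lambda>h. - (inverse (norm z ^ n) *
      (of_nat n * (h \<bullet> z / norm z) * norm z ^ (n - 1)) * inverse (norm z ^ n)))) (at z)"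
    by simp
  moreover have "- (inverse (norm z ^ n) * (of_nat n * (h \<bullet> z / norm z) * norm z ^ (n - 1)) * inverse (norm z ^ n))
      = - (real n * inverse (norm z ^ (n + 2)) * (z \<bullet> h))" for h
    using assms(1) by (simp add: n field_simps inner_commute power2_eq_square)
  ultimately show ?thesis by simp
qed

lemma has_derivative_vec_nth': "((\<lambda>z::real^'n. z $ i) has_derivative (\<lambda>h. h $ i)) F"
  by (rule bounded_linear_imp_has_derivative) (rule bounded_linear_vec_nth)

lemma sum_nth_scaleR_axis: "(\<Sum>i\<in>UNIV. h $ i *\<^sub>R axis i 1) = (h::real^'n)"
  by (simp add: vec_eq_iff axis_def if_distrib[of "(*) _"] cong: if_cong)

lemma sum_nth_scaleR_nth: "(\<Sum>j\<in>UNIV. h $ j *\<^sub>R (c * z $ j) *\<^sub>R v) = (c * (z \<bullet> h)) *\<^sub>R v"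
  for h z :: "real^'n" and v :: "'b::real_vector"
proof -
  have "(\<Sum>j\<in>UNIV. h $ j *\<^sub>R (c * z $ j) *\<^sub>R v) = (\<Sum>j\<in>UNIV. c * (z $ j * h $ j)) *\<^sub>R v"
    unfolding scaleR_left.sum by (intro sum.cong) (auto simp: mult_ac)
  then show ?thesis
    by (simp add: inner_vec_eq_sum sum_distrib_left)
qed

lemma charge_field_has_derivative:
  assumes "z \<noteq> 0"
  shows "(charge_field has_derivative (\<lambda>h. \<Sum>i\<in>UNIV. h $ i *\<^sub>R charge_field_d1 i z)) (at z)"
proof -
  define A where "A k = inverse (norm z ^ k)" for k
  have "(\<Sum>i\<in>UNIV. h $ i *\<^sub>R charge_field_d1 i z) = A 3 *\<^sub>R h - (3 * A 5 * (z \<bullet> h)) *\<^sub>R z" for h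
  proof -
    have "(\<Sum>i\<in>UNIV. h $ i *\<^sub>R charge_field_d1 i z)
      = A 3 *\<^sub>R (\<Sum>i\<in>UNIV. h $ i *\<^sub>R axis i 1) - (\<Sum>i\<in>UNIV. h $ i *\<^sub>R (3 * A 5 * z $ i) *\<^sub>R z)"
      unfolding scaleR_sum_right sum_subtractf[symmetric]
      by (intro sum.cong) (auto simp: charge_field_d1_def A_def scaleR_diff_right mult_ac)
    then show ?thesis
      by (simp only: sum_nth_scaleR_axis sum_nth_scaleR_nth)
  qed
  moreover have "(charge_field has_derivative
     (\<lambda>h. inverse (norm z ^ 3) *\<^sub>R h + - (real 3 * inverse (norm z ^ (3 + 2)) * (z \<bullet> h)) *\<^sub>R z)) (at z)"
    unfolding charge_field_def[abs_def]
    by (rule has_derivative_scaleR[OF has_derivative_inverse_norm_power[OF assms] has_derivative_ident]) simp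
  ultimately show ?thesis
    by (simp add: A_def)
qed

lemma charge_field_d1_has_derivative:
  assumes "z \<noteq> 0"
  shows "(charge_field_d1 i has_derivative (\<lambda>h. \<Sum>j\<in>UNIV. h $ j *\<^sub>R charge_field_d2 i j z)) (at z)"
proof -
  define A where "A k = inverse (norm z ^ k)" for k
  have eq: "(\<Sum>j\<in>UNIV. h $ j *\<^sub>R charge_field_d2 i j z) =
      - (3 * A 5 * (z \<bullet> h)) *\<^sub>R axis i 1 - (3 * z $ i * A 5) *\<^sub>R h
      - (3 * A 5 * h $ i) *\<^sub>R z + (15 * z $ i * A 7 * (z \<bullet> h)) *\<^sub>R z" for h
  proof -
    have "(\<Sum>j\<in>UNIV. h $ j *\<^sub>R charge_field_d2 i j z) =
      - (\<Sum>j\<in>UNIV. h $ j *\<^sub>R (3 * A 5 * z $ j) *\<^sub>R axis i 1)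
      - (3 * z $ i * A 5) *\<^sub>R (\<Sum>j\<in>UNIV. h $ j *\<^sub>R axis j 1)
      - (\<Sum>j\<in>UNIV. (if i = j then (3 * A 5 * h $ j) *\<^sub>R z else 0))
      + (\<Sum>j\<in>UNIV. h $ j *\<^sub>R (15 * z $ i * A 7 * z $ j) *\<^sub>R z)"
      unfolding scaleR_sum_right sum_subtractf[symmetric] sum_negf[symmetric] sum.distrib[symmetric]
      by (intro sum.cong)
        (auto simp: charge_field_d2_def A_def scaleR_diff_right scaleR_add_right mult_ac)
    then show ?thesis
      unfolding sum_nth_scaleR_axis sum_nth_scaleR_nth by simp
  qed
  have "(charge_field_d1 i has_derivative
     (\<lambda>h. - (real 3 * inverse (norm z ^ (3 + 2)) * (z \<bullet> h)) *\<^sub>R axis i 1 -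
       ((3 * z $ i * inverse (norm z ^ 5)) *\<^sub>R h
        + (3 * z $ i * - (real 5 * inverse (norm z ^ (5 + 2)) * (z \<bullet> h)) + 3 * h $ i * inverse (norm z ^ 5)) *\<^sub>R z))) (at z)"
    unfolding charge_field_d1_def[abs_def]
    by (intro has_derivative_diff has_derivative_scaleR has_derivative_scaleR_left has_derivative_mult
        has_derivative_mult_right has_derivative_vec_nth'
        has_derivative_inverse_norm_power[OF assms] has_derivative_ident) auto
  then show ?thesis
    unfolding eq by (rule has_derivative_eq_rhs) (auto simp: A_def algebra_simps)
qed

lemma continuous_on_charge_field: "continuous_on (- {0}) charge_field"
  unfolding charge_field_def[abs_def] by (intro continuous_intros) auto

lemma continuous_on_charge_field_d1: "continuous_on (- {0}) (charge_field_d1 i)"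
  unfolding charge_field_d1_def[abs_def] by (intro continuous_intros) auto

lemma continuous_on_charge_field_d2: "continuous_on (- {0}) (charge_field_d2 i j)"
  unfolding charge_field_d2_def[abs_def] by (intro continuous_intros) auto

text \<open>The exponent matches the dimension: the trace of the identity contributes 3 |z|^-3, and
  the other term contributes -3 |z|^-5 |z|^2.\<close>

lemma charge_field_divergence_free:
  fixes z :: "real^3"
  shows "(\<Sum>i\<in>UNIV. charge_field_d1 i z $ i) = 0"
proof (cases "z = 0")
  case False
  have "(\<Sum>i\<in>UNIV. charge_field_d1 i z $ i)
      = 3 * inverse (norm z ^ 3) - 3 * inverse (norm z ^ 5) * (\<Sum>i\<in>UNIV. z $ i * z $ i)"
    by (simp add: charge_field_d1_def sum_subtractf sum_distrib_left axis_def mult_ac)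
  also have "(\<Sum>i\<in>UNIV. z $ i * z $ i) = norm z ^ 2"
    by (simp add: power2_norm_eq_inner inner_vec_eq_sum)
  finally show ?thesis using False
    by (simp add: field_simps eval_nat_numeral)
qed (simp add: charge_field_d1_def)

text \<open>The coefficients of |z|^-5 z are -6 from the two axis terms, -9 from the diagonal term
  counted once per dimension, and 15; they add up to 0.\<close>

lemma charge_field_harmonic:
  fixes z :: "real^3"
  shows "(\<Sum>i\<in>UNIV. charge_field_d2 i i z) = 0"
proof (cases "z = 0")
  case False
  have "(\<Sum>i\<in>UNIV. charge_field_d2 i i z)
      = - (6 * inverse (norm z ^ 5)) *\<^sub>R (\<Sum>i\<in>UNIV. z $ i *\<^sub>R axis i 1)
        - (9 * inverse (norm z ^ 5)) *\<^sub>R z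
        + (15 * inverse (norm z ^ 7) * (\<Sum>i\<in>UNIV. z $ i * z $ i)) *\<^sub>R z"
    unfolding sum_3 by (simp add: charge_field_d2_def algebra_simps vec_eq_iff)
  also have "(\<Sum>i\<in>UNIV. z $ i * z $ i) = norm z ^ 2"
    by (simp add: power2_norm_eq_inner inner_vec_eq_sum)
  also have "15 * inverse (norm z ^ 7) * norm z ^ 2 = 15 * inverse (norm z ^ 5)"
    using False by (simp add: field_simps eval_nat_numeral)
  finally show ?thesis
    unfolding sum_nth_scaleR_axis by (simp flip: scaleR_left_distrib scaleR_diff_left add: algebra_simps)
qed (simp add: charge_field_d2_def)

lemma norm_charge_field: "norm (charge_field z) = inverse (norm z ^ 2)"
  by (cases "z = 0") (auto simp: charge_field_def power2_eq_square power3_eq_cube)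

lemma norm_charge_field_d1_le: "norm (charge_field_d1 i z) \<le> 4 * inverse (norm z ^ 3)"
proof (cases "z = 0")
  case False
  have "norm (charge_field_d1 i z) \<le> inverse (norm z ^ 3) + 3 * \<bar>z $ i\<bar> * inverse (norm z ^ 5) * norm z"
    unfolding charge_field_d1_def
    by (rule order_trans[OF norm_triangle_ineq4]) (auto simp: abs_mult)
  also have "\<dots> \<le> inverse (norm z ^ 3) + 3 * norm z * inverse (norm z ^ 5) * norm z"
    using component_le_norm_cart[of z i] by (intro add_left_mono mult_right_mono mult_left_mono) auto
  also have "\<dots> = 4 * inverse (norm z ^ 3)"
    using False by (simp add: field_simps eval_nat_numeral)
  finally show ?thesis .
qed (simp add: charge_field_d1_def)

section \<open>Convolution of a vector field with a singular kernel\<close>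

text \<open>For \<open>K = charge_field\<close> this is, up to a constant factor, the potential of
  the dipole density W; other K give its derivatives. The singularity at y = x is harmless where W
  vanishes near x, and the lemmas below evaluate it only there.\<close>

definition kernel_integral :: "(real^'n \<Rightarrow> real^'n) \<Rightarrow> (real^'n \<Rightarrow> real^'n) \<Rightarrow> real^'n::finite \<Rightarrow> real" where
  "kernel_integral K W x = integral UNIV (\<lambda>y. W y \<bullet> K (x - y))"

text \<open>The domain is covered by two open sets: the pairs with y in the ball, where the
  integrand is 0, and the pairs off the diagonal, where K is continuous.\<close>

lemma continuous_on_kernel_integrand:
  fixes W K :: "real^'n::finite \<Rightarrow> real^'n"
  assumes W: "continuous_on UNIV W" and K: "continuous_on (- {0}) K"
    and W0: "\<And>y. y \<in> ball x0 r \<Longrightarrow> W y = 0"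
  shows "continuous_on (ball x0 r \<times> UNIV) (\<lambda>(x, y). W y \<bullet> K (x - y))"
proof -
  have "continuous_on (UNIV \<times> ball x0 r) (\<lambda>(x, y). W y \<bullet> K (x - y))"
    by (rule continuous_on_eq[where f="\<lambda>_. 0"]) (auto simp: W0)
  moreover have "open {p::(real^'n) \<times> (real^'n). fst p \<noteq> snd p}"
    by (intro open_Collect_neq continuous_intros)
  moreover have "continuous_on {p. fst p \<noteq> snd p} (\<lambda>(x, y). W y \<bullet> K (x - y))"
    unfolding split_beta
    by (intro continuous_intros continuous_on_compose2[OF W] continuous_on_compose2[OF K]) auto
  ultimately have "continuous_on (UNIV \<times> ball x0 r \<union> {p. fst p \<noteq> snd p}) (\<lambda>(x, y). W y \<bullet> K (x - y))"
    by (intro continuous_on_open_Un open_Times) auto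
  then show ?thesis
    by (rule continuous_on_subset) auto
qed

lemma continuous_kernel_integrand:
  fixes W K :: "real^'n::finite \<Rightarrow> real^'n"
  assumes "continuous_on UNIV W" "continuous_on (- {0}) K" "r > 0"
    and "\<And>y. y \<in> ball x r \<Longrightarrow> W y = 0"
  shows "continuous_on UNIV (\<lambda>y. W y \<bullet> K (x - y))"
proof -
  have "continuous_on (ball x r \<times> UNIV) (\<lambda>(x, y). W y \<bullet> K (x - y))"
    using assms by (intro continuous_on_kernel_integrand)
  moreover have "continuous_on UNIV (\<lambda>y. (x, y))" "(\<lambda>y. (x, y)) ` UNIV \<subseteq> ball x r \<times> UNIV"
    using assms(3) by (auto intro!: continuous_intros)
  ultimately show ?thesis
    using continuous_on_compose2 by fastforce
qed

lemma integrable_kernel_integrand: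
  fixes W K :: "real^'n::finite \<Rightarrow> real^'n"
  assumes "continuous_on UNIV W" "continuous_on (- {0}) K" "r > 0"
    and "\<And>y. y \<in> ball x r \<Longrightarrow> W y = 0" and "bounded {y. W y \<noteq> 0}"
  shows "(\<lambda>y. W y \<bullet> K (x - y)) integrable_on UNIV"
  by (rule integrable_on_UNIV_compact_support[OF continuous_kernel_integrand[OF assms(1-4)]])
    (auto intro: bounded_subset[OF assms(5)])

lemma kernel_integral_has_derivative:
  fixes W K :: "real^'n::finite \<Rightarrow> real^'n"
  assumes W: "continuous_on UNIV W" and supp: "bounded {y. W y \<noteq> 0}"
    and W0: "\<And>y. y \<in> ball x0 r \<Longrightarrow> W y = 0" and r: "r > 0"
    and K: "\<And>z. z \<noteq> 0 \<Longrightarrow> (K has_derivative (\<lambda>h. \<Sum>i\<in>UNIV. h $ i *\<^sub>R K1 i z)) (at z)"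
    and K1: "\<And>i. continuous_on (- {0}) (K1 i)"
  shows "(kernel_integral K W has_derivative (\<lambda>h. \<Sum>i\<in>UNIV. h $ i * kernel_integral (K1 i) W x0)) (at x0)"
proof -
  obtain a b where ab: "\<And>y. y \<notin> cbox a b \<Longrightarrow> W y = 0"
    using bounded_support_obtain_cbox[OF supp] by metis
  have KI: "kernel_integral K' W x = integral (cbox a b) (\<lambda>y. W y \<bullet> K' (x - y))" for K' x
    unfolding kernel_integral_def by (rule integral_UNIV_eq_cbox) (simp add: ab)
  have contK: "continuous_on (- {0}) K"
    using K by (intro continuous_at_imp_continuous_on) (auto intro!: has_derivative_continuous)
  \<comment> \<open>The coordinate functionals as bounded linear maps, the form in which
    \<open>leibniz_rule\<close> expects a derivative.\<close>
  define B :: "'n \<Rightarrow> (real^'n) \<Rightarrow>\<^sub>L real" where "B i = blinfun_inner_left (axis i 1)" for i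
  define F where "F x y = (\<Sum>i\<in>UNIV. (W y \<bullet> K1 i (x - y)) *\<^sub>R B i)" for x y
  have B: "blinfun_apply (B i) h = h $ i" for i h
    by (simp add: B_def inner_axis)
  have joint: "continuous_on (ball x0 r \<times> cbox a b) (\<lambda>(x, y). W y \<bullet> K' (x - y))"
    if "continuous_on (- {0}) K'" for K'
    using continuous_on_kernel_integrand[OF W that W0] by (rule continuous_on_subset) auto
  have slice: "(\<lambda>y. W y \<bullet> K' (x - y)) integrable_on cbox a b"
    if "continuous_on (- {0}) K'" "x \<in> ball x0 r" for K' x
  proof -
    have "continuous_on (cbox a b) (\<lambda>y. (x, y))" "(\<lambda>y. (x, y)) ` cbox a b \<subseteq> ball x0 r \<times> cbox a b"
      using that(2) by (auto intro!: continuous_intros)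
    then show ?thesis
      using continuous_on_compose2[OF joint[OF that(1)]] by (fastforce intro: integrable_continuous)
  qed
  have "((\<lambda>x. integral (cbox a b) (\<lambda>y. W y \<bullet> K (x - y))) has_derivative
          blinfun_apply (integral (cbox a b) (F x0))) (at x0 within ball x0 r)"
  proof (rule leibniz_rule)
    fix x y assume x: "x \<in> ball x0 r"
    show "((\<lambda>x. W y \<bullet> K (x - y)) has_derivative blinfun_apply (F x y)) (at x within ball x0 r)"
    proof (cases "y \<in> ball x0 r")
      case True
      then show ?thesis by (simp add: W0 F_def zero_blinfun.rep_eq)
    next
      case False
      then have "x - y \<noteq> 0" using x by auto
      have "((\<lambda>x. x - y) has_derivative (\<lambda>h. h)) (at x within ball x0 r)"
        by (auto intro!: derivative_eq_intros)
      note has_derivative_compose[OF this K[OF \<open>x - y \<noteq> 0\<close>]]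
      from has_derivative_inner_right[OF this] show ?thesis
        by (rule has_derivative_eq_rhs)
          (auto simp: fun_eq_iff F_def blinfun.sum_left blinfun.scaleR_left B inner_sum_right mult_ac)
    qed
  next
    show "continuous_on (ball x0 r \<times> cbox a b) (\<lambda>(x, y). F x y)"
      using joint[OF K1] unfolding F_def split_beta
        by (intro continuous_on_sum continuous_on_scaleR continuous_on_const) auto
  qed (use slice[OF contK] r in auto)
  moreover have "integral (cbox a b) (F x0) = (\<Sum>i\<in>UNIV. kernel_integral (K1 i) W x0 *\<^sub>R B i)"
  proof -
    have "integral (cbox a b) (F x0)
        = (\<Sum>i\<in>UNIV. integral (cbox a b) (\<lambda>y. (W y \<bullet> K1 i (x0 - y)) *\<^sub>R B i))"
      unfolding F_def
      by (intro integral_sum integrable_on_scaleR_left slice[OF K1]) (use r in auto)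
    also have "\<dots> = (\<Sum>i\<in>UNIV. kernel_integral (K1 i) W x0 *\<^sub>R B i)"
      unfolding KI
      by (intro sum.cong refl integral_unique has_integral_scaleR_left integrable_integral slice[OF K1])
        (use r in auto)
    finally show ?thesis .
  qed
  ultimately have "((\<lambda>x. integral (cbox a b) (\<lambda>y. W y \<bullet> K (x - y))) has_derivative
      blinfun_apply (\<Sum>i\<in>UNIV. kernel_integral (K1 i) W x0 *\<^sub>R B i)) (at x0)"
    using r at_within_open[of x0 "ball x0 r"] by simp
  moreover have "blinfun_apply (\<Sum>i\<in>UNIV. kernel_integral (K1 i) W x0 *\<^sub>R B i)
      = (\<lambda>h. \<Sum>i\<in>UNIV. h $ i * kernel_integral (K1 i) W x0)"
    by (simp add: fun_eq_iff blinfun.sum_left blinfun.scaleR_left B mult.commute)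
  moreover have "kernel_integral K W = (\<lambda>x. integral (cbox a b) (\<lambda>y. W y \<bullet> K (x - y)))"
    by (rule ext) (rule KI)
  ultimately show ?thesis
    by simp
qed

lemma continuous_on_kernel_integral:
  fixes W K :: "real^'n::finite \<Rightarrow> real^'n"
  assumes W: "continuous_on UNIV W" and supp: "bounded {y. W y \<noteq> 0}"
    and W0: "\<And>x. x \<in> S \<Longrightarrow> \<exists>r>0. \<forall>y\<in>ball x r. W y = 0"
    and K: "continuous_on (- {0}) K"
  shows "continuous_on S (kernel_integral K W)"
proof (rule continuous_at_imp_continuous_on, rule ballI)
  fix x0 assume "x0 \<in> S"
  then obtain r where r: "r > 0" "\<And>y. y \<in> ball x0 r \<Longrightarrow> W y = 0"
    using W0 by metis
  obtain a b where ab: "\<And>y. y \<notin> cbox a b \<Longrightarrow> W y = 0"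
    using bounded_support_obtain_cbox[OF supp] by metis
  have KI: "kernel_integral K W x = integral (cbox a b) (\<lambda>y. W y \<bullet> K (x - y))" for x
    unfolding kernel_integral_def by (rule integral_UNIV_eq_cbox) (simp add: ab)
  have "continuous_on (ball x0 r) (kernel_integral K W)"
    unfolding KI[abs_def]
    by (rule integral_continuous_on_param)
      (rule continuous_on_subset[OF continuous_on_kernel_integrand[OF W K r(2)]], auto)
  then show "isCont (kernel_integral K W) x0"
    using r(1) continuous_on_interior[of "ball x0 r" "kernel_integral K W" x0] by simp
qed

text \<open>The integral is estimated ball by ball. Overlaps of the balls need no count here, since
  the bound on W is already a sum over them; K is estimated only where W is nonzero, which keeps the
  singularity out.\<close>

lemma kernel_integral_bound:
  fixes W K :: "real^'n::finite \<Rightarrow> real^'n"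
  assumes W: "continuous_on UNIV W" and supp: "bounded {y. W y \<noteq> 0}"
    and W0: "\<And>y. y \<in> ball x r \<Longrightarrow> W y = 0" and r: "r > 0"
    and K: "continuous_on (- {0}) K"
    and S: "finite S" and B: "B \<ge> 0"
    and Wb: "\<And>y. norm (W y) \<le> B * (\<Sum>k\<in>S. indicator (cball (q k) R) y)"
    and Kb: "\<And>k y. k \<in> S \<Longrightarrow> y \<in> cball (q k) R \<Longrightarrow> W y \<noteq> 0 \<Longrightarrow> norm (K (x - y)) \<le> b k"
  shows "\<bar>kernel_integral K W x\<bar> \<le> B * measure lborel (cball (0::real^'n) R) * (\<Sum>k\<in>S. \<bar>b k\<bar>)"
proof -
  have ind: "(indicator (cball p R) has_integral measure lborel (cball (0::real^'n) R)) UNIV" for p :: "real^'n"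
  proof -
    have "((\<lambda>y. if y \<in> cball p R then 1 else 0) has_integral measure lborel (cball p R)) UNIV"
      unfolding has_integral_restrict_UNIV
      by (rule has_integral_measure_lborel) (use emeasure_lborel_cball_finite in auto)
    moreover have "(\<lambda>y. if y \<in> cball p R then 1 else 0) = (indicator (cball p R) :: real^'n \<Rightarrow> real)"
      by (auto simp: indicator_def)
    moreover have "measure lborel (cball p R) = measure lborel (cball (0::real^'n) R)"
      by (cases "R \<ge> 0") (simp_all add: content_cball)
    ultimately show ?thesis by simp
  qed
  have g: "((\<lambda>y. B * (\<Sum>k\<in>S. \<bar>b k\<bar> * indicator (cball (q k) R) y)) has_integral
      B * (\<Sum>k\<in>S. \<bar>b k\<bar> * measure lborel (cball (0::real^'n) R))) UNIV"
    by (intro has_integral_mult_right has_integral_sum S ind)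
  have "norm (kernel_integral K W x) \<le> integral UNIV (\<lambda>y. B * (\<Sum>k\<in>S. \<bar>b k\<bar> * indicator (cball (q k) R) y))"
    unfolding kernel_integral_def
  proof (rule integral_norm_bound_integral)
    show "(\<lambda>y. W y \<bullet> K (x - y)) integrable_on UNIV"
      by (rule integrable_kernel_integrand[OF W K r W0 supp])
    show "(\<lambda>y. B * (\<Sum>k\<in>S. \<bar>b k\<bar> * indicator (cball (q k) R) y)) integrable_on UNIV"
      using g by blast
    fix y
    have "norm (W y \<bullet> K (x - y)) \<le> norm (W y) * norm (K (x - y))"
      by (simp add: Cauchy_Schwarz_ineq2)
    also have "\<dots> \<le> B * (\<Sum>k\<in>S. \<bar>b k\<bar> * indicator (cball (q k) R) y)"
    proof (cases "W y = 0")
      case False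
      have "norm (W y) * norm (K (x - y)) \<le> B * (\<Sum>k\<in>S. indicator (cball (q k) R) y) * norm (K (x - y))"
        by (intro mult_right_mono Wb) auto
      also have "\<dots> = B * (\<Sum>k\<in>S. norm (K (x - y)) * indicator (cball (q k) R) y)"
        by (simp add: sum_distrib_left sum_distrib_right mult_ac)
      also have "\<dots> \<le> B * (\<Sum>k\<in>S. \<bar>b k\<bar> * indicator (cball (q k) R) y)"
        using Kb[OF _ _ False]
        by (intro mult_left_mono sum_mono B) (fastforce simp: indicator_def)
      finally show ?thesis .
    qed (use B in \<open>auto intro!: mult_nonneg_nonneg sum_nonneg\<close>)
    finally show "norm (W y \<bullet> K (x - y)) \<le> B * (\<Sum>k\<in>S. \<bar>b k\<bar> * indicator (cball (q k) R) y)" .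
  qed
  also have "\<dots> = B * measure lborel (cball (0::real^'n) R) * (\<Sum>k\<in>S. \<bar>b k\<bar>)"
    using integral_unique[OF g] by (simp add: sum_distrib_left sum_distrib_right mult_ac)
  finally show ?thesis by simp
qed

section \<open>Smooth cutoffs around finite point sets\<close>

text \<open>Squaring removes the kink of the truncation. At 0 the difference quotient is
  \<open>max 0 y\<close> itself, which tends to 0.\<close>

lemma max_0_square_has_derivative:
  "((\<lambda>s::real. (max 0 s)\<^sup>2) has_real_derivative 2 * max 0 s) (at s)"
proof -
  consider "s < 0" | "s = 0" | "s > 0" by linarith
  then show ?thesis
  proof cases
    case 1
    have "((\<lambda>s::real. 0) has_real_derivative 2 * max 0 s) (at s)"
      using 1 by simp
    then show ?thesis
      by (rule has_field_derivative_transform_within_open[where S="{..<0}"]) (use 1 in auto)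
  next
    case 2
    have "(\<lambda>y::real. max 0 y) \<midarrow>0\<rightarrow> max 0 0"
      by (intro tendsto_intros)
    moreover have "(\<lambda>y::real. ((max 0 y)\<^sup>2 - (max 0 0)\<^sup>2) / (y - 0)) = (\<lambda>y. max 0 y)"
      by (auto simp: max_def power2_eq_square)
    ultimately have "(\<lambda>y::real. ((max 0 y)\<^sup>2 - (max 0 0)\<^sup>2) / (y - 0)) \<midarrow>0\<rightarrow> 0"
      by simp
    then show ?thesis
      using 2 unfolding has_field_derivative_iff by simp
  next
    case 3
    have "((\<lambda>s::real. s\<^sup>2) has_real_derivative 2 * max 0 s) (at s)"
      using 3 by (auto intro!: derivative_eq_intros)
    then show ?thesis
      by (rule has_field_derivative_transform_within_open[where S="{0<..}"]) (use 3 in auto)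
  qed
qed

text \<open>The constant 10 satisfies 3^2 + 1 \<le> 10 \<le> 4^2: the bump is at least 1 up to
  distance 3 and is 0 from distance 4 on. Radius 3 leaves a margin of 1 around the balls of radius 2
  that will cover the tube.\<close>

definition bump :: "'a::real_inner \<Rightarrow> 'a \<Rightarrow> real" where
  "bump q y = (max 0 (10 - (norm (y - q))\<^sup>2))\<^sup>2"

definition bump_grad :: "'a::real_inner \<Rightarrow> 'a \<Rightarrow> 'a" where
  "bump_grad q y = - (4 * max 0 (10 - (norm (y - q))\<^sup>2)) *\<^sub>R (y - q)"

text \<open>A C^1 version of truncating the bump sum at 1: the function 1 - (max 0 (1 - s))^2 rises
  from 0 at s = 0 to 1 at s = 1 and stays there.\<close>

definition cutoff :: "'k set \<Rightarrow> ('k \<Rightarrow> 'a::real_inner) \<Rightarrow> 'a \<Rightarrow> real" where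
  "cutoff S q y = 1 - (max 0 (1 - (\<Sum>k\<in>S. bump (q k) y)))\<^sup>2"

definition cutoff_grad :: "'k set \<Rightarrow> ('k \<Rightarrow> 'a::real_inner) \<Rightarrow> 'a \<Rightarrow> 'a" where
  "cutoff_grad S q y = (2 * max 0 (1 - (\<Sum>k\<in>S. bump (q k) y))) *\<^sub>R (\<Sum>k\<in>S. bump_grad (q k) y)"

lemma bump_has_derivative: "(bump q has_derivative (\<lambda>h. bump_grad q y \<bullet> h)) (at y)"
proof -
  have "((\<lambda>y. 10 - (norm (y - q))\<^sup>2) has_derivative (\<lambda>h. - (2 * ((y - q) \<bullet> h)))) (at y)"
    unfolding power2_norm_eq_inner
    by (auto intro!: derivative_eq_intros simp: inner_commute)
  from has_derivative_compose[OF this max_0_square_has_derivative[unfolded has_field_derivative_def]]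
  show ?thesis
    unfolding bump_def[abs_def]
    by (rule has_derivative_eq_rhs) (auto simp: bump_grad_def fun_eq_iff)
qed

lemma cutoff_has_derivative: "(cutoff S q has_derivative (\<lambda>h. cutoff_grad S q y \<bullet> h)) (at y)"
proof -
  have "((\<lambda>y. 1 - (\<Sum>k\<in>S. bump (q k) y)) has_derivative (\<lambda>h. 0 - (\<Sum>k\<in>S. bump_grad (q k) y \<bullet> h))) (at y)"
    by (intro has_derivative_diff has_derivative_const has_derivative_sum bump_has_derivative)
  from has_derivative_compose[OF this max_0_square_has_derivative[unfolded has_field_derivative_def]]
  have "((\<lambda>y. (max 0 (1 - (\<Sum>k\<in>S. bump (q k) y)))\<^sup>2) has_derivative
     (\<lambda>h. 2 * max 0 (1 - (\<Sum>k\<in>S. bump (q k) y)) * (0 - (\<Sum>k\<in>S. bump_grad (q k) y \<bullet> h)))) (at y)" .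
  from has_derivative_diff[OF has_derivative_const[of 1] this]
  show ?thesis
    unfolding cutoff_def[abs_def]
    by (rule has_derivative_eq_rhs) (auto simp: cutoff_grad_def fun_eq_iff inner_sum_left)
qed

lemma continuous_on_cutoff_grad: "continuous_on A (cutoff_grad S q)"
  unfolding cutoff_grad_def[abs_def] bump_def bump_grad_def by (intro continuous_intros)

lemma bump_nonneg: "bump q y \<ge> 0"
  by (simp add: bump_def)

lemma bump_ge_1:
  assumes "dist y q \<le> 3"
  shows "bump q y \<ge> 1"
proof -
  have "(norm (y - q))\<^sup>2 \<le> 3\<^sup>2"
    using assms by (intro power_mono) (auto simp: dist_norm)
  then have "1 \<le> max 0 (10 - (norm (y - q))\<^sup>2)" by simp
  then show ?thesis unfolding bump_def by (rule one_le_power)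
qed

lemma bump_outside:
  assumes "dist y q \<ge> 4"
  shows "bump q y = 0" "bump_grad q y = 0"
proof -
  have "4\<^sup>2 \<le> (norm (y - q))\<^sup>2"
    using assms by (intro power_mono) (auto simp: dist_norm)
  then have "max 0 (10 - (norm (y - q))\<^sup>2) = 0" by simp
  then show "bump q y = 0" "bump_grad q y = 0" 
    by (simp_all only: bump_def bump_grad_def) auto
qed

lemma norm_bump_grad_le: "norm (bump_grad q y) \<le> 160 * indicator (cball q 4) y"
proof (cases "dist y q \<ge> 4")
  case True
  then show ?thesis by (simp add: bump_outside indicator_def)
next
  case False
  have "norm (bump_grad q y) = 4 * (max 0 (10 - (norm (y - q))\<^sup>2)) * norm (y - q)"
    by (simp add: bump_grad_def)
  also have "\<dots> \<le> 4 * 10 * 4"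
    using False by (intro mult_mono) (auto simp: dist_norm)
  finally show ?thesis using False by (simp add: indicator_def dist_commute)
qed

lemma cutoff_eq_1:
  assumes "finite S" "k \<in> S" "dist y (q k) \<le> 3"
  shows "cutoff S q y = 1" "cutoff_grad S q y = 0"
proof -
  have "1 \<le> bump (q k) y" by (rule bump_ge_1[OF assms(3)])
  also have "\<dots> \<le> (\<Sum>k\<in>S. bump (q k) y)"
    using assms by (intro member_le_sum bump_nonneg)
  finally have "max 0 (1 - (\<Sum>k\<in>S. bump (q k) y)) = 0" by simp
  then show "cutoff S q y = 1" "cutoff_grad S q y = 0"
    by (simp_all only: cutoff_def cutoff_grad_def) auto
qed

lemma cutoff_eq_0:
  assumes "\<And>k. k \<in> S \<Longrightarrow> dist y (q k) \<ge> 4"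
  shows "cutoff S q y = 0" "cutoff_grad S q y = 0"
  using assms by (simp_all add: cutoff_def cutoff_grad_def bump_outside)

lemma norm_cutoff_grad_le: "norm (cutoff_grad S q y) \<le> 320 * (\<Sum>k\<in>S. indicator (cball (q k) 4) y)"
proof -
  have "(\<Sum>k\<in>S. bump (q k) y) \<ge> 0"
    by (intro sum_nonneg bump_nonneg)
  then have "norm (cutoff_grad S q y) \<le> 2 * norm (\<Sum>k\<in>S. bump_grad (q k) y)"
    unfolding cutoff_grad_def norm_scaleR by (intro mult_right_mono) auto
  also have "norm (\<Sum>k\<in>S. bump_grad (q k) y) \<le> (\<Sum>k\<in>S. 160 * indicator (cball (q k) 4) y)"
    by (intro sum_norm_le norm_bump_grad_le)
  finally show ?thesis by (simp add: sum_distrib_left)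
qed

lemma bounded_support_cutoff:
  assumes "finite S"
  shows "bounded {y. cutoff S q y \<noteq> 0}" "bounded {y. cutoff_grad S q y \<noteq> 0}"
proof -
  have b: "bounded (\<Union>k\<in>S. ball (q k) 4)"
    using assms by auto
  show "bounded {y. cutoff S q y \<noteq> 0}" "bounded {y. cutoff_grad S q y \<noteq> 0}"
    by (rule bounded_subset[OF b], use cutoff_eq_0[of S _ q] in \<open>force simp: dist_commute not_le\<close>)+
qed

section \<open>Gauss' law\<close>

text \<open>The integrand is the divergence of \<open>\<phi>\<close> times the field, up to sign.\<close>
lemma kernel_integral_charge_free:
  fixes \<phi> :: "real^3 \<Rightarrow> real"
  assumes \<phi>: "\<And>y. (\<phi> has_derivative (\<lambda>h. D y \<bullet> h)) (at y)"
    and D: "continuous_on UNIV D" and supp: "bounded {y. \<phi> y \<noteq> 0}" "bounded {y. D y \<noteq> 0}"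
    and r: "r > 0" and zero: "\<And>y. y \<in> ball x r \<Longrightarrow> \<phi> y = 0" "\<And>y. y \<in> ball x r \<Longrightarrow> D y = 0"
  shows "kernel_integral charge_field D x = 0"
proof -
  \<comment> \<open>\<open>G i\<close> is the i-th component of \<phi> times the field, and
    \<open>E i\<close> is its gradient, so the divergence is the sum of the i-th components of the
    \<open>E i\<close>.\<close>
  define G where "G i y = \<phi> y * charge_field (x - y) $ i" for i y
  define E where "E i y = charge_field (x - y) $ i *\<^sub>R D y
      - (\<Sum>j\<in>UNIV. (\<phi> y * charge_field_d1 j (x - y) $ i) *\<^sub>R axis j 1)" for i y
  have cont\<phi>: "continuous_on UNIV \<phi>"
    using \<phi> by (intro continuous_at_imp_continuous_on) (auto intro: has_derivative_continuous)
  have G: "(G i has_derivative (\<lambda>h. E i y \<bullet> h)) (at y)" for i y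
  \<comment> \<open>At the singularity the product vanishes in a whole ball, so the value given to
    the field at 0 is immaterial.\<close>
  proof (cases "y = x")
    case True
    have "((\<lambda>_. 0) has_derivative (\<lambda>h. E i y \<bullet> h)) (at y)"
      using True r by (simp add: E_def zero)
    then show ?thesis
      by (rule has_derivative_transform_within_open[where s="ball x r"])
        (use True r in \<open>auto simp: G_def zero\<close>)
  next
    case False
    then have "x - y \<noteq> 0" by simp
    have "((\<lambda>y. x - y) has_derivative uminus) (at y)"
      by (auto intro!: derivative_eq_intros)
    from has_derivative_compose[OF this charge_field_has_derivative[OF \<open>x - y \<noteq> 0\<close>]]
    have "((\<lambda>y. charge_field (x - y) $ i) has_derivative
        (\<lambda>h. (\<Sum>j\<in>UNIV. (- h) $ j *\<^sub>R charge_field_d1 j (x - y)) $ i)) (at y)"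
      by (rule has_derivative_compose[OF _ has_derivative_vec_nth'])
    from has_derivative_mult[OF \<phi>[of y] this] show ?thesis
      unfolding G_def[abs_def]
      by (rule has_derivative_eq_rhs)
        (auto simp: fun_eq_iff E_def inner_diff_left inner_sum_left inner_axis' sum_negf sum_distrib_left algebra_simps)
  qed
  have "continuous_on (ball x r) (E i)" for i
    by (rule continuous_on_eq[where f="\<lambda>_. 0"]) (auto simp: E_def zero)
  moreover have "continuous_on (- {x}) (E i)" for i
    unfolding E_def[abs_def]
    by (intro continuous_intros continuous_on_compose2[OF continuous_on_charge_field]
        continuous_on_compose2[OF continuous_on_charge_field_d1]
        continuous_on_compose2[OF D] continuous_on_compose2[OF cont\<phi>]) auto
  ultimately have "continuous_on (ball x r \<union> - {x}) (E i)" for i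
    by (intro continuous_on_open_Un) auto
  moreover have "ball x r \<union> - {x} = UNIV"
    using r by auto
  ultimately have contE: "continuous_on UNIV (E i)" for i
    by metis
  have suppG: "bounded {y. G i y \<noteq> 0}" for i
    by (rule bounded_subset[OF supp(1)]) (auto simp: G_def)
  have suppE: "bounded {y. E i y \<bullet> e \<noteq> 0}" for i e
    by (rule bounded_subset[of "{y. \<phi> y \<noteq> 0} \<union> {y. D y \<noteq> 0}"]) (use supp in \<open>auto simp: E_def\<close>)
  \<comment> \<open>The divergence has two terms; the one containing the divergence of the field
    vanishes, and the other is the integrand wanted.\<close>
  have "kernel_integral charge_field D x = integral UNIV (\<lambda>y. \<Sum>i\<in>UNIV. E i y \<bullet> axis i 1)"
    unfolding kernel_integral_def
  proof (rule arg_cong[where f="integral UNIV"], rule ext)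
    fix y
    have "E i y $ i = charge_field (x - y) $ i * D y $ i - \<phi> y * charge_field_d1 i (x - y) $ i" for i
      by (simp add: E_def axis_def if_distrib[of "(*) _"] cong: if_cong)
    moreover have "E i y \<bullet> axis i 1 = E i y $ i" for i
      by (simp add: inner_axis)
    ultimately have "(\<Sum>i\<in>UNIV. E i y \<bullet> axis i 1)
        = D y \<bullet> charge_field (x - y) - \<phi> y * (\<Sum>i\<in>UNIV. charge_field_d1 i (x - y) $ i)"
      by (simp add: inner_vec_eq_sum sum_subtractf sum_distrib_left mult.commute)
    then show "D y \<bullet> charge_field (x - y) = (\<Sum>i\<in>UNIV. E i y \<bullet> axis i 1)"
      by (simp add: charge_field_divergence_free)
  qed
  also have "\<dots> = (\<Sum>i\<in>UNIV. integral UNIV (\<lambda>y. E i y \<bullet> axis i 1))"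
    by (intro integral_sum integrable_on_UNIV_compact_support suppE continuous_intros contE) auto
  also have "\<dots> = 0"
    using integral_directional_derivative_eq_0[OF G contE suppG] by simp
  finally show ?thesis .
qed

text \<open>The constant is $4\pi$, but only its positivity matters; it is read off from one reference cutoff.\<close>
definition gauss_const :: real where
  "gauss_const = kernel_integral charge_field (cutoff_grad {0::nat} (\<lambda>_. 0 :: real^3)) 0"

text \<open>The cutoff gradient and \<open>charge_field (0 - y)\<close> both point towards the
  origin, so the integrand is nonnegative.\<close>

lemma gauss_const_pos: "gauss_const > 0"
proof -
  let ?q = "\<lambda>_::nat. 0 :: real^3"
  have z: "cutoff_grad {0} ?q y = 0" if "y \<in> ball 0 3" for y
    using that cutoff_eq_1(2)[of "{0}" 0 y ?q] by auto
  have eq: "cutoff_grad {0} ?q y \<bullet> charge_field (0 - y)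
      = 8 * max 0 (1 - bump 0 y) * max 0 (10 - (norm y)\<^sup>2) * (inverse (norm y ^ 3) * (norm y)\<^sup>2)" for y
    by (simp add: cutoff_grad_def bump_grad_def charge_field_def power2_norm_eq_inner)
  have nonneg: "0 \<le> cutoff_grad {0} ?q y \<bullet> charge_field (0 - y)" for y
    unfolding eq by (intro mult_nonneg_nonneg) auto
  \<comment> \<open>The squared norm 19/2 makes the bump equal to (1/2)^2, strictly between 0 and 1,
    so the cutoff is neither flat nor saturated at \<open>y0\<close>.\<close>
  define y0 :: "real^3" where "y0 = sqrt (19/2) *\<^sub>R axis 1 1"
  have y0: "(norm y0)\<^sup>2 = 19 / 2" "norm y0 > 0"
    by (simp_all add: y0_def norm_axis_1)
  have "bump 0 y0 = 1 / 4"
    by (simp add: bump_def y0(1)) (simp add: power2_eq_square)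
  then have "cutoff_grad {0} ?q y0 \<bullet> charge_field (0 - y0) > 0"
    unfolding eq using y0 by simp
  then show ?thesis
    unfolding gauss_const_def kernel_integral_def
    by (intro integral_continuous_pos[of _ y0]
        continuous_kernel_integrand[OF continuous_on_cutoff_grad continuous_on_charge_field, where r=3])
      (auto intro: z bounded_subset[OF bounded_support_cutoff(2)[of "{0}" ?q]] nonneg[simplified])
qed

text \<open>Subtracting a multiple of the reference cutoff centred at \<open>x\<close> removes the value of \<open>\<phi>\<close> near \<open>x\<close>,
  so that the charge-free case applies.\<close>
lemma gauss_law:
  fixes \<phi> :: "real^3 \<Rightarrow> real"
  assumes \<phi>: "\<And>y. (\<phi> has_derivative (\<lambda>h. D y \<bullet> h)) (at y)"
    and D: "continuous_on UNIV D" and supp: "bounded {y. \<phi> y \<noteq> 0}" "bounded {y. D y \<noteq> 0}"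
    and r: "r > 0" and zero: "\<And>y. y \<in> ball x r \<Longrightarrow> D y = 0"
  shows "kernel_integral charge_field D x = gauss_const * \<phi> x"
proof -
  let ?q = "\<lambda>_::nat. x"
  define E where "E y = cutoff_grad {0} ?q y" for y
  \<comment> \<open>On this ball \<phi> is constant and the reference cutoff is identically
    1.\<close>
  define s where "s = min r 3"
  have s: "s > 0" "s \<le> r" "s \<le> 3" using r by (auto simp: s_def)
  have const: "\<phi> y = \<phi> x" if "y \<in> ball x s" for y
  proof (rule has_derivative_zero_unique[of "ball x s"])
    show "(\<phi> has_derivative (\<lambda>h. 0)) (at y within ball x s)" if "y \<in> ball x s" for y
      using \<phi>[of y] zero[of y] that s by (auto intro: has_derivative_at_withinI)
  qed (use that s in auto)
  have E0: "E y = 0" "cutoff {0} ?q y = 1" if "y \<in> ball x s" for y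
    using that s cutoff_eq_1[of "{0}" 0 y ?q] by (auto simp: E_def dist_commute)
  have contE: "continuous_on UNIV E"
    unfolding E_def by (rule continuous_on_cutoff_grad)
  have suppE: "bounded {y. E y \<noteq> 0}"
    unfolding E_def by (rule bounded_support_cutoff) simp
  have "kernel_integral charge_field (\<lambda>y. D y - \<phi> x *\<^sub>R E y) x = 0"
  proof (rule kernel_integral_charge_free[where \<phi>="\<lambda>y. \<phi> y - \<phi> x * cutoff {0} ?q y"])
    show "((\<lambda>y. \<phi> y - \<phi> x * cutoff {0} ?q y) has_derivative (\<lambda>h. (D y - \<phi> x *\<^sub>R E y) \<bullet> h)) (at y)" for y
      by (rule has_derivative_eq_rhs,
          rule has_derivative_diff[OF \<phi> has_derivative_mult_right[OF cutoff_has_derivative]])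
        (auto simp: E_def inner_diff_left)
    show "bounded {y. \<phi> y - \<phi> x * cutoff {0} ?q y \<noteq> 0}"
      by (rule bounded_subset[of "{y. \<phi> y \<noteq> 0} \<union> {y. cutoff {0} ?q y \<noteq> 0}"])
        (use supp(1) bounded_support_cutoff(1)[of "{0}" ?q] in auto)
    show "bounded {y. D y - \<phi> x *\<^sub>R E y \<noteq> 0}"
      by (rule bounded_subset[of "{y. D y \<noteq> 0} \<union> {y. E y \<noteq> 0}"]) (use supp(2) suppE in auto)
    show "continuous_on UNIV (\<lambda>y. D y - \<phi> x *\<^sub>R E y)"
      by (intro continuous_intros D contE)
    show "\<phi> y - \<phi> x * cutoff {0} ?q y = 0" if "y \<in> ball x s" for y
      using const[OF that] E0(2)[OF that] by simp
    show "D y - \<phi> x *\<^sub>R E y = 0" if "y \<in> ball x s" for y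
      using zero[of y] E0(1)[OF that] that s by simp
  qed (rule s)
  moreover have "kernel_integral charge_field (\<lambda>y. D y - \<phi> x *\<^sub>R E y) x
      = kernel_integral charge_field D x - \<phi> x * kernel_integral charge_field E x"
  proof -
    have "(\<lambda>y. D y \<bullet> charge_field (x - y)) integrable_on UNIV"
      "(\<lambda>y. E y \<bullet> charge_field (x - y)) integrable_on UNIV"
      by (intro integrable_kernel_integrand[OF D continuous_on_charge_field r zero supp(2)]
          integrable_kernel_integrand[OF contE continuous_on_charge_field s(1) E0(1) suppE]; assumption)+
    from has_integral_diff[OF integrable_integral[OF this(1)]
        has_integral_mult_right[OF integrable_integral[OF this(2)]]]
    show ?thesis
      unfolding kernel_integral_def inner_diff_left inner_scaleR_left
      by (rule integral_unique)
  qed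
  moreover have "kernel_integral charge_field E x = gauss_const"
  proof -
    have "cutoff_grad {0} (\<lambda>_::nat. 0 :: real^3) (y + - x) = E y" for y
      by (simp add: E_def cutoff_grad_def bump_def bump_grad_def)
    moreover have "bounded {y. cutoff_grad {0} (\<lambda>_::nat. 0 :: real^3) y \<bullet> charge_field (0 - y) \<noteq> 0}"
      by (rule bounded_subset[OF bounded_support_cutoff(2)[of "{0}" "\<lambda>_::nat. 0"]]) auto
    ultimately show ?thesis
      using integral_UNIV_translate[of
          "\<lambda>y. cutoff_grad {0} (\<lambda>_::nat. 0 :: real^3) y \<bullet> charge_field (0 - y)" "-x"]
      by (simp add: kernel_integral_def gauss_const_def)
  qed
  ultimately show ?thesis by simp
qed

section \<open>Harmonic functions with their derivatives\<close>

text \<open>The derivatives are carried along as explicit functions, so that they can be estimated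
  and transformed without \<open>frechet_derivative\<close>. The value space is general because the
  step functions are real and the approximant is complex.\<close>

definition has_harmonic_derivatives ::
    "(real^'n::finite \<Rightarrow> 'b::real_normed_vector) \<Rightarrow> ('n \<Rightarrow> real^'n \<Rightarrow> 'b) \<Rightarrow>
     ('n \<Rightarrow> 'n \<Rightarrow> real^'n \<Rightarrow> 'b) \<Rightarrow> (real^'n) set \<Rightarrow> bool" where
  "has_harmonic_derivatives u u1 u2 S \<longleftrightarrow> open S \<and>
     (\<forall>x\<in>S. (u has_derivative (\<lambda>h. \<Sum>i\<in>UNIV. h $ i *\<^sub>R u1 i x)) (at x)) \<and>
     (\<forall>i. \<forall>x\<in>S. (u1 i has_derivative (\<lambda>h. \<Sum>j\<in>UNIV. h $ j *\<^sub>R u2 i j x)) (at x)) \<and>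
     (\<forall>i j. continuous_on S (u2 i j)) \<and> (\<forall>x\<in>S. (\<Sum>i\<in>UNIV. u2 i i x) = 0)"

lemma sum_axis_nth_scaleR:
  fixes v :: "'n::finite \<Rightarrow> 'b::real_vector"
  shows "(\<Sum>i\<in>UNIV. (axis l 1 :: real^'n) $ i *\<^sub>R v i) = v l"
proof -
  have "(\<Sum>i\<in>UNIV. (axis l 1 :: real^'n) $ i *\<^sub>R v i) = (\<Sum>i\<in>UNIV. if i = l then v i else 0)"
    by (intro sum.cong) (auto simp: axis_def)
  then show ?thesis by simp
qed

lemma has_harmonic_derivatives_imp:
  assumes "has_harmonic_derivatives u u1 u2 S"
  shows "harmonic_on u S" and "x \<in> S \<Longrightarrow> gradient u x = (\<chi> i. u1 i x)"
proof -
  have S: "open S"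
    and d1: "\<And>x. x \<in> S \<Longrightarrow> (u has_derivative (\<lambda>h. \<Sum>i\<in>UNIV. h $ i *\<^sub>R u1 i x)) (at x)"
    and d2: "\<And>i x. x \<in> S \<Longrightarrow> (u1 i has_derivative (\<lambda>h. \<Sum>j\<in>UNIV. h $ j *\<^sub>R u2 i j x)) (at x)"
    and cont: "\<And>i j. continuous_on S (u2 i j)"
    and lap: "\<And>x. x \<in> S \<Longrightarrow> (\<Sum>i\<in>UNIV. u2 i i x) = 0"
    using assms unfolding has_harmonic_derivatives_def by auto
  have p1: "partial_derivative i u x = u1 i x" if "x \<in> S" for i x
    unfolding partial_derivative_def frechet_derivative_at[OF d1[OF that], symmetric]
    by (rule sum_axis_nth_scaleR)
  \<comment> \<open>The partial derivative is known to agree with \<open>u1 i\<close> only on S;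
    openness of S suffices to transfer the derivative.\<close>
  have d2': "(partial_derivative i u has_derivative (\<lambda>h. \<Sum>j\<in>UNIV. h $ j *\<^sub>R u2 i j x)) (at x)"
    if "x \<in> S" for i x
    by (rule has_derivative_transform_within_open[OF d2[OF that] S that]) (simp add: p1)
  have p2: "partial_derivative j (partial_derivative i u) x = u2 i j x" if "x \<in> S" for i j x
    unfolding partial_derivative_def[of j] frechet_derivative_at[OF d2'[OF that], symmetric]
    by (rule sum_axis_nth_scaleR)
  have "continuous_on S (partial_derivative j (partial_derivative i u))" for i j
    using cont[of i j] by (rule continuous_on_eq) (simp add: p2)
  then show "harmonic_on u S"
    unfolding harmonic_on_def twice_continuously_differentiable_on_def laplacian_def
    using S lap differentiableI[OF d1] differentiableI[OF d2'] by (simp add: p2)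
  show "gradient u x = (\<chi> i. u1 i x)" if "x \<in> S"
    using p1[OF that] by (simp add: gradient_def)
qed

text \<open>Away from the density all derivatives pass to the kernel, and the trace of the
  second-order kernels is 0 by \<open>charge_field_harmonic\<close>.\<close>

lemma kernel_integral_has_harmonic_derivatives:
  fixes W :: "real^3 \<Rightarrow> real^3"
  assumes W: "continuous_on UNIV W" "bounded {y. W y \<noteq> 0}" and S: "open S"
    and W0: "\<And>x. x \<in> S \<Longrightarrow> \<exists>r>0. \<forall>y\<in>ball x r. W y = 0"
  shows "has_harmonic_derivatives (kernel_integral charge_field W)
    (\<lambda>i. kernel_integral (charge_field_d1 i) W) (\<lambda>i j. kernel_integral (charge_field_d2 i j) W) S"
  unfolding has_harmonic_derivatives_def
proof (intro conjI allI ballI S)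
  fix x assume "x \<in> S"
  then obtain r where r: "r > 0" "\<And>y. y \<in> ball x r \<Longrightarrow> W y = 0"
    using W0 by metis
  show "(kernel_integral charge_field W has_derivative
      (\<lambda>h. \<Sum>i\<in>UNIV. h $ i *\<^sub>R kernel_integral (charge_field_d1 i) W x)) (at x)"
    using kernel_integral_has_derivative[OF W r(2,1) charge_field_has_derivative continuous_on_charge_field_d1]
    by simp
  show "(kernel_integral (charge_field_d1 i) W has_derivative
      (\<lambda>h. \<Sum>j\<in>UNIV. h $ j *\<^sub>R kernel_integral (charge_field_d2 i j) W x)) (at x)" for i
    using kernel_integral_has_derivative[OF W r(2,1) charge_field_d1_has_derivative continuous_on_charge_field_d2]
    by simp
  have "(\<lambda>y. W y \<bullet> charge_field_d2 i i (x - y)) integrable_on UNIV" for i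
    by (rule integrable_kernel_integrand[OF W(1) continuous_on_charge_field_d2 r W(2)])
  then have "(\<Sum>i\<in>UNIV. kernel_integral (charge_field_d2 i i) W x)
      = integral UNIV (\<lambda>y. \<Sum>i\<in>UNIV. W y \<bullet> charge_field_d2 i i (x - y))"
    unfolding kernel_integral_def by (subst integral_sum) auto
  then show "(\<Sum>i\<in>UNIV. kernel_integral (charge_field_d2 i i) W x) = 0"
    by (simp add: inner_sum_right[symmetric] charge_field_harmonic)
next
  show "continuous_on S (kernel_integral (charge_field_d2 i j) W)" for i j
    by (rule continuous_on_kernel_integral[OF W W0 continuous_on_charge_field_d2])
qed

section \<open>Harmonic step functions along a chain of points\<close>

lemma sum_inverse_squares_le: "(\<Sum>l<n. 1 / (1 + real l)\<^sup>2) \<le> 2"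
proof -
  \<comment> \<open>The subtracted term carries the induction, by 1/(m+1)^2 \<le> 1/m -
    1/(m+1).\<close>
  have "(\<Sum>l<Suc n. 1 / (1 + real l)\<^sup>2) \<le> 2 - 1 / (1 + real n)" for n
  proof (induction n)
    case (Suc n)
    have "1 / (1 + real (Suc n))\<^sup>2 \<le> 1 / ((1 + real n) * (1 + real (Suc n)))"
      unfolding power2_eq_square by (intro divide_left_mono mult_right_mono) auto
    also have "\<dots> = 1 / (1 + real n) - 1 / (1 + real (Suc n))"
      by (simp add: field_simps)
    finally have "1 / (1 + real (Suc n))\<^sup>2 \<le> 1 / (1 + real n) - 1 / (1 + real (Suc n))" .
    then show ?case using Suc by simp
  qed simp
  from this[of n] have "(\<Sum>l<Suc n. 1 / (1 + real l)\<^sup>2) \<le> 2"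
    by (rule order_trans) simp
  moreover have "(\<Sum>l<n. 1 / (1 + real l)\<^sup>2) \<le> (\<Sum>l<Suc n. 1 / (1 + real l)\<^sup>2)"
    by simp
  ultimately show ?thesis by linarith
qed

text \<open>The sum is split at j, and each half is a one-sided sum bounded by 2. The lower half is
  reversed by k \<mapsto> j - 1 - k, which gives the distances k + 1 \<ge> k.\<close>

lemma sum_inverse_square_distances_le:
  assumes "finite S"
  shows "(\<Sum>k\<in>S. 1 / (1 + \<bar>real k - real j\<bar>)\<^sup>2) \<le> 4"
proof -
  obtain n where n: "S \<subseteq> {..<j + n}"
    using assms by (metis finite_nat_iff_bounded le_add2 lessThan_subset_iff order_trans)
  have "(\<Sum>k\<in>S. 1 / (1 + \<bar>real k - real j\<bar>)\<^sup>2) \<le> (\<Sum>k<j + n. 1 / (1 + \<bar>real k - real j\<bar>)\<^sup>2)"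
    using n by (intro sum_mono2) auto
  also have "\<dots> = (\<Sum>k<j. 1 / (1 + \<bar>real k - real j\<bar>)\<^sup>2) + (\<Sum>k<n. 1 / (1 + \<bar>real (j + k) - real j\<bar>)\<^sup>2)"
    by (induction n) simp_all
  also have "(\<Sum>k<j. 1 / (1 + \<bar>real k - real j\<bar>)\<^sup>2) = (\<Sum>k<j. 1 / (1 + \<bar>real (j - Suc k) - real j\<bar>)\<^sup>2)"
    by (rule sum.nat_diff_reindex[symmetric])
  also have "\<dots> \<le> (\<Sum>k<j. 1 / (1 + real k)\<^sup>2)"
    by (intro sum_mono divide_left_mono power_mono) (auto simp: of_nat_diff)
  also have "\<dots> \<le> 2"
    by (rule sum_inverse_squares_le)
  also have "(\<Sum>k<n. 1 / (1 + \<bar>real (j + k) - real j\<bar>)\<^sup>2) \<le> 2"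
    using sum_inverse_squares_le[of n] by simp
  finally show ?thesis by simp
qed

text \<open>One common bound for the field and its first derivatives, so that values and gradients
  can be estimated together; the better cubic decay of the derivatives is given away.\<close>

lemma inverse_powers_le:
  fixes s a d :: real
  assumes "s \<ge> a * (1 + d)" "0 < a" "a \<le> 1" "0 \<le> d"
  shows "inverse (s ^ 2) \<le> 4 / a ^ 3 / (1 + d)\<^sup>2" "4 * inverse (s ^ 3) \<le> 4 / a ^ 3 / (1 + d)\<^sup>2"
proof -
  have p: "0 < a * (1 + d)" using assms by simp
  have "inverse (s ^ 2) \<le> inverse ((a * (1 + d)) ^ 2)"
    using assms(1) p by (intro le_imp_inverse_le power_mono) auto
  also have "\<dots> = 1 / a ^ 2 / (1 + d)\<^sup>2"
    by (simp only: power_mult_distrib inverse_eq_divide divide_divide_eq_left)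
  also have "\<dots> \<le> 4 / a ^ 3 / (1 + d)\<^sup>2"
    using assms by (intro divide_right_mono) (auto simp: field_simps eval_nat_numeral)
  finally show "inverse (s ^ 2) \<le> 4 / a ^ 3 / (1 + d)\<^sup>2" .
  have "inverse (s ^ 3) \<le> inverse ((a * (1 + d)) ^ 3)"
    using assms(1) p by (intro le_imp_inverse_le power_mono) auto
  also have "\<dots> = 1 / a ^ 3 / (1 + d) ^ 3"
    by (simp only: power_mult_distrib inverse_eq_divide divide_divide_eq_left)
  also have "\<dots> \<le> 1 / a ^ 3 / (1 + d) ^ 2"
    using assms by (intro divide_left_mono power_increasing) auto
  finally show "4 * inverse (s ^ 3) \<le> 4 / a ^ 3 / (1 + d)\<^sup>2" by simp
qed

text \<open>The chain after dilation by 1/\<delta>; c will be the reciprocal of the chord-arc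
  constant.\<close>

locale separated_chain =
  fixes q :: "nat \<Rightarrow> real^3" and N :: nat and c :: real
  assumes c: "0 < c" "c \<le> 1"
    and separated: "\<And>j k. j \<le> N \<Longrightarrow> k \<le> N \<Longrightarrow> c * \<bar>real j - real k\<bar> \<le> dist (q j) (q k)"
    and steps: "\<And>j k. j \<le> N \<Longrightarrow> k \<le> N \<Longrightarrow> dist (q j) (q k) \<le> \<bar>real j - real k\<bar>"
begin

text \<open>A point closer than 3 to some \<open>q j\<close> with \<open>j < i\<close> and closer than 4 to some \<open>q k\<close> with \<open>k \<ge> i\<close> satisfies
  \<open>c * (i - j) \<le> 7\<close>, hence lies within \<open>radius - 1\<close> of \<open>q i\<close>.\<close>
definition radius :: real where "radius = 4 + 7 / c"

text \<open>It equals 1 within \<open>radius - 1\<close> of \<open>q i\<close> and 0 beyond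
  \<open>radius\<close>. It splits the dipole density into a kept part \<open>outer\<close> and a
  deleted part \<open>inner_part\<close>.\<close>

definition near :: "nat \<Rightarrow> real^3 \<Rightarrow> real" where
  "near i y = max 0 (min 1 (radius - dist y (q i)))"

definition outer :: "nat \<Rightarrow> real^3 \<Rightarrow> real^3" where
  "outer i y = (1 - near i y) *\<^sub>R cutoff_grad {i..N} q y"

definition inner_part :: "nat \<Rightarrow> real^3 \<Rightarrow> real^3" where
  "inner_part i y = near i y *\<^sub>R cutoff_grad {i..N} q y"

lemma near_bounds: "0 \<le> near i y" "near i y \<le> 1"
  by (auto simp: near_def)

lemma continuous_outer_inner: "continuous_on A (outer i)" "continuous_on A (inner_part i)"
proof -
  have "continuous_on A (near i)"
    unfolding near_def[abs_def] by (intro continuous_intros)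
  then show "continuous_on A (outer i)" "continuous_on A (inner_part i)"
    unfolding outer_def[abs_def] inner_part_def[abs_def]
    by (auto intro!: continuous_on_scaleR continuous_on_diff continuous_on_const continuous_on_cutoff_grad)
qed

lemma bounded_support_outer_inner:
  "bounded {y. outer i y \<noteq> 0}" "bounded {y. inner_part i y \<noteq> 0}"
proof -
  have b: "bounded {y. cutoff_grad {i..N} q y \<noteq> 0}"
    by (rule bounded_support_cutoff) simp
  show "bounded {y. outer i y \<noteq> 0}"
    by (rule bounded_subset[OF b]) (auto simp: outer_def)
  show "bounded {y. inner_part i y \<noteq> 0}"
    by (rule bounded_subset[OF b]) (auto simp: inner_part_def)
qed

lemma norm_outer_inner_le:
  "norm (outer i y) \<le> 320 * (\<Sum>k\<in>{i..N}. indicator (cball (q k) 4) y)"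
  "norm (inner_part i y) \<le> 320 * (\<Sum>k\<in>{i..N}. indicator (cball (q k) 4) y)"
proof -
  have "norm (outer i y) \<le> 1 * norm (cutoff_grad {i..N} q y)"
    "norm (inner_part i y) \<le> 1 * norm (cutoff_grad {i..N} q y)"
    unfolding outer_def inner_part_def norm_scaleR
    using near_bounds[of i y] by (intro mult_right_mono; simp)+
  then show "norm (outer i y) \<le> 320 * (\<Sum>k\<in>{i..N}. indicator (cball (q k) 4) y)"
    "norm (inner_part i y) \<le> 320 * (\<Sum>k\<in>{i..N}. indicator (cball (q k) 4) y)"
    using norm_cutoff_grad_le[of "{i..N}" q y] by linarith+
qed

text \<open>For i \<le> j the cutoff is flat at 1 near \<open>q j\<close>. For i > j either all its
  bumps are out of reach, or separation puts y within 3 + 7/c of \<open>q i\<close>, where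
  \<open>1 - near i y\<close> is 0.\<close>

lemma outer_eq_0:
  assumes "i \<le> N" "j \<le> N" "dist y (q j) \<le> 3"
  shows "outer i y = 0"
proof (cases "i \<le> j")
  case True
  then show ?thesis
    using cutoff_eq_1(2)[of "{i..N}" j y q] assms by (simp add: outer_def)
next
  case False
  show ?thesis
  proof (cases "\<forall>k\<in>{i..N}. dist y (q k) \<ge> 4")
    case True
    then show ?thesis
      using cutoff_eq_0(2)[of "{i..N}" y q] by (simp add: outer_def)
  next
    case far: False
    then obtain k where k: "i \<le> k" "k \<le> N" "dist y (q k) < 4" by auto
    have "c * \<bar>real j - real i\<bar> \<le> c * \<bar>real j - real k\<bar>"
      using c k False by (intro mult_left_mono) auto
    also have "\<dots> \<le> dist (q j) (q k)"
      using assms k by (intro separated) auto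
    also have "\<dots> \<le> 7"
      using k assms dist_triangle[of "q j" "q k" y] by (simp add: dist_commute)
    finally have "\<bar>real j - real i\<bar> \<le> 7 / c"
      using c by (simp add: field_simps)
    then have "dist y (q i) \<le> radius - 1"
      using steps[of j i] assms dist_triangle[of y "q i" "q j"] by (simp add: radius_def)
    then show ?thesis
      by (simp add: outer_def near_def)
  qed
qed

text \<open>The threshold comes from 3 + 4 = 7: if j < i and c |i - j| \<ge> 7, every
  \<open>q k\<close> with k \<ge> i is at distance at least 7 from \<open>q j\<close>, hence at
  least 4 from y.\<close>

lemma cutoff_far:
  assumes "i \<le> N" "j \<le> N" "dist y (q j) \<le> 3" "\<bar>real i - real j\<bar> \<ge> 7 / c"
  shows "cutoff_grad {i..N} q y = 0" "cutoff {i..N} q y = (if i \<le> j then 1 else 0)"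
proof -
  have "cutoff_grad {i..N} q y = 0 \<and> cutoff {i..N} q y = (if i \<le> j then 1 else 0)"
  proof (cases "i \<le> j")
    case True
    then show ?thesis
      using cutoff_eq_1[of "{i..N}" j y q] assms by simp
  next
    case False
    have "dist y (q k) \<ge> 4" if "k \<in> {i..N}" for k
    proof -
      have "7 \<le> c * \<bar>real i - real j\<bar>"
        using assms(4) c by (simp add: field_simps)
      also have "\<dots> \<le> c * \<bar>real j - real k\<bar>"
        using c that False by (intro mult_left_mono) auto
      also have "\<dots> \<le> dist (q j) (q k)"
        using assms that by (intro separated) auto
      finally show ?thesis
        using assms(3) dist_triangle[of "q j" "q k" y] by (simp add: dist_commute)
    qed
    then show ?thesis
      using False cutoff_eq_0[of "{i..N}" y q] by simp
  qed
  then show "cutoff_grad {i..N} q y = 0" "cutoff {i..N} q y = (if i \<le> j then 1 else 0)"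
    by auto
qed

lemma norm_kernel_le:
  assumes "K = charge_field \<or> K = charge_field_d1 l"
    and "a * (1 + d) \<le> norm z" "0 < a" "a \<le> 1" "0 \<le> d"
  shows "norm (K z :: real^3) \<le> 4 / a ^ 3 / (1 + d)\<^sup>2"
  using assms(1)
proof
  assume "K = charge_field"
  then show ?thesis
    using inverse_powers_le(1)[OF assms(2-)] by (simp add: norm_charge_field)
next
  assume "K = charge_field_d1 l"
  then show ?thesis
    using inverse_powers_le(2)[OF assms(2-)] norm_charge_field_d1_le[of l z] by simp
qed

text \<open>The density may run along the whole chain, but the kernel at x decays quadratically in
  |k - j|, so the bound is independent of N. It shows no decay in |i - j| and serves for i close to
  j.\<close>

lemma kernel_integral_outer_le:
  assumes "i \<le> N" "j \<le> N" "x \<in> ball (q j) 2" and K: "K = charge_field \<or> K = charge_field_d1 l"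
  shows "\<bar>kernel_integral K (outer i) x\<bar>
    \<le> 320 * measure lborel (cball (0::real^3) 4) * (4 * (4 / (c / 8) ^ 3))"
proof -
  define b where "b k = 4 / (c / 8) ^ 3 / (1 + \<bar>real k - real j\<bar>)\<^sup>2" for k
  have contK: "continuous_on (- {0}) K"
    using K continuous_on_charge_field continuous_on_charge_field_d1 by auto
  have zero: "outer i y = 0" if "y \<in> ball x 1" for y
    using that assms dist_triangle[of y "q j" x]
    by (intro outer_eq_0[of i j]) (auto simp: dist_commute)
  have "\<bar>kernel_integral K (outer i) x\<bar>
      \<le> 320 * measure lborel (cball (0::real^3) 4) * (\<Sum>k\<in>{i..N}. \<bar>b k\<bar>)"
  proof (rule kernel_integral_bound[OF continuous_outer_inner(1) bounded_support_outer_inner(1)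
        zero _ contK _ _ norm_outer_inner_le(1)])
    fix k y assume k: "k \<in> {i..N}" and y: "y \<in> cball (q k) 4" "outer i y \<noteq> 0"
    have 1: "norm (x - y) \<ge> 1"
      using zero[of y] y(2) by (auto simp: dist_norm not_less[symmetric])
    have "c * \<bar>real k - real j\<bar> \<le> dist (q k) (q j)"
      using k assms by (intro separated) auto
    also have "\<dots> \<le> dist (q k) y + dist y x + dist x (q j)"
      using dist_triangle[of "q k" "q j" y] dist_triangle[of y "q j" x] by linarith
    also have "\<dots> \<le> norm (x - y) + 6"
      using y(1) assms(3) by (auto simp: dist_norm norm_minus_commute)
    \<comment> \<open>With n = \<open>norm (x - y)\<close>, the bounds c \<le> 1 \<le> n give c (1 +
      |k - j|) \<le> 1 + (n + 6) \<le> 8 n.\<close>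
    finally have "c / 8 * (1 + \<bar>real k - real j\<bar>) \<le> norm (x - y)"
      using 1 c by (simp add: distrib_left)
    then show "norm (K (x - y)) \<le> b k"
      unfolding b_def using c by (intro norm_kernel_le[OF K]) auto
  qed auto
  also have "(\<Sum>k\<in>{i..N}. \<bar>b k\<bar>) = 4 / (c / 8) ^ 3 * (\<Sum>k\<in>{i..N}. 1 / (1 + \<bar>real k - real j\<bar>)\<^sup>2)"
    unfolding b_def sum_distrib_left using c by (intro sum.cong) auto
  also have "\<dots> \<le> 4 / (c / 8) ^ 3 * 4"
    using c by (intro mult_left_mono sum_inverse_square_distances_le) auto
  finally show ?thesis
    by (simp add: mult.commute mult_left_mono)
qed

text \<open>The deleted density lies within \<open>radius\<close> of \<open>q i\<close>, so the
  kernel is small on all of it, of order (1 + |i - j|)^-2.\<close>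

lemma kernel_integral_inner_le:
  assumes "i \<le> N" "j \<le> N" "x \<in> ball (q j) 2" and K: "K = charge_field \<or> K = charge_field_d1 l"
    and far: "\<bar>real i - real j\<bar> \<ge> 2 * (2 + radius) / c"
  shows "\<bar>kernel_integral K (inner_part i) x\<bar>
    \<le> 320 * measure lborel (cball (0::real^3) 4) *
        (4 * (4 / (c / 4) ^ 3) * (1 + (radius + 4) / c)\<^sup>2) / (1 + \<bar>real i - real j\<bar>)\<^sup>2"
proof -
  define m where "m = (radius + 4) / c"
  define \<beta> where "\<beta> = 4 / (c / 4) ^ 3 / (1 + \<bar>real i - real j\<bar>)\<^sup>2"
  \<comment> \<open>Only the indices \<open>k\<close> with \<open>\<bar>k - i\<bar> \<le> m\<close> contribute; for these the factor of \<open>\<beta>\<close> is at least 1.\<close>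
  define b where "b k = \<beta> * ((1 + m)\<^sup>2 * (1 / (1 + \<bar>real k - real i\<bar>)\<^sup>2))" for k
  have r: "radius > 4" and m: "m \<ge> 0" and \<beta>: "\<beta> \<ge> 0"
    using c by (auto simp: radius_def m_def \<beta>_def)
  have far': "c * \<bar>real i - real j\<bar> \<ge> 2 * (2 + radius)" and d1: "\<bar>real i - real j\<bar> \<ge> 1"
  proof -
    show "c * \<bar>real i - real j\<bar> \<ge> 2 * (2 + radius)"
      using far c by (simp add: field_simps)
    also have "c * \<bar>real i - real j\<bar> \<le> 1 * \<bar>real i - real j\<bar>"
      using c by (intro mult_right_mono) auto
    finally show "\<bar>real i - real j\<bar> \<ge> 1" using r by simp
  qed
  have contK: "continuous_on (- {0}) K"
    using K continuous_on_charge_field continuous_on_charge_field_d1 by auto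
  have apart: "dist y (q i) < radius" if "inner_part i y \<noteq> 0" for y
    using that by (auto simp: inner_part_def near_def max_def min_def split: if_splits)
  have dist_ge: "c / 4 * (1 + \<bar>real i - real j\<bar>) \<le> norm (x - y)" if "inner_part i y \<noteq> 0" for y
  proof -
    have "c * \<bar>real i - real j\<bar> \<le> dist (q i) (q j)"
      using assms by (intro separated) auto
    also have "\<dots> \<le> dist (q i) y + dist y x + dist x (q j)"
      using dist_triangle[of "q i" "q j" y] dist_triangle[of y "q j" x] by linarith
    also have "\<dots> \<le> norm (x - y) + (radius + 2)"
      using apart[OF that] assms(3) by (auto simp: dist_norm norm_minus_commute)
    \<comment> \<open>The threshold in \<open>far\<close> makes \<open>radius + 2\<close> at most
      half of c |i - j|.\<close>
    finally have "c / 2 * \<bar>real i - real j\<bar> \<le> norm (x - y)"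
      using far' by simp
    moreover have "c / 4 * 1 \<le> c / 4 * \<bar>real i - real j\<bar>"
      using d1 c by (intro mult_left_mono) auto
    ultimately show ?thesis by (simp add: algebra_simps)
  qed
  have "\<bar>kernel_integral K (inner_part i) x\<bar>
      \<le> 320 * measure lborel (cball (0::real^3) 4) * (\<Sum>k\<in>{i..N}. \<bar>b k\<bar>)"
  proof (rule kernel_integral_bound[OF continuous_outer_inner(2) bounded_support_outer_inner(2)
        _ _ contK _ _ norm_outer_inner_le(2)])
    show "inner_part i y = 0" if "y \<in> ball x (c / 4)" for y
    proof (rule ccontr)
      assume "inner_part i y \<noteq> 0"
      from dist_ge[OF this] have "c / 4 * 1 \<le> norm (x - y)"
        by (rule order_trans[rotated]) (use c in \<open>intro mult_left_mono, auto\<close>)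
      then show False using that by (simp add: dist_norm)
    qed
    fix k y assume k: "k \<in> {i..N}" and y: "y \<in> cball (q k) 4" "inner_part i y \<noteq> 0"
    have "c * \<bar>real k - real i\<bar> \<le> dist (q k) (q i)"
      using k assms by (intro separated) auto
    also have "\<dots> \<le> radius + 4"
      using y(1) apart[OF y(2)] dist_triangle[of "q k" "q i" y] by (simp add: dist_commute)
    finally have "\<bar>real k - real i\<bar> \<le> m"
      using c by (simp add: m_def field_simps)
    then have "1 \<le> (1 + m)\<^sup>2 * (1 / (1 + \<bar>real k - real i\<bar>)\<^sup>2)"
      by (simp add: power_mono)
    then have "\<beta> * 1 \<le> b k"
      unfolding b_def using \<beta> by (intro mult_left_mono) auto
    moreover have "norm (K (x - y)) \<le> \<beta>"
      unfolding \<beta>_def using c dist_ge[OF y(2)] by (intro norm_kernel_le[OF K]) auto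
    ultimately show "norm (K (x - y)) \<le> b k" by linarith
  qed (use c in auto)
  \<comment> \<open>The weights replace a count of the contributing indices by a sum that is at most
    4 for every N.\<close>
  also have "(\<Sum>k\<in>{i..N}. \<bar>b k\<bar>) = \<beta> * (1 + m)\<^sup>2 * (\<Sum>k\<in>{i..N}. 1 / (1 + \<bar>real k - real i\<bar>)\<^sup>2)"
    unfolding b_def sum_distrib_left using \<beta> by (intro sum.cong) (auto simp: abs_mult)
  also have "\<dots> \<le> \<beta> * (1 + m)\<^sup>2 * 4"
    using \<beta> by (intro mult_left_mono sum_inverse_square_distances_le) auto
  finally show ?thesis
    by (simp add: \<beta>_def m_def mult_ac mult_left_mono)
qed

text \<open>Near x the full density vanishes, and Gauss' law evaluates its potential as the exact
  step. This trades the long-range density \<open>outer i\<close> for the localized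
  \<open>inner_part i\<close>.\<close>

lemma gauss_outer_inner:
  assumes "i \<le> N" "j \<le> N" "x \<in> ball (q j) 2"
    and far: "\<bar>real i - real j\<bar> \<ge> 2 * (2 + radius) / c"
  shows "kernel_integral charge_field (outer i) x
    = gauss_const * (if i \<le> j then 1 else 0) - kernel_integral charge_field (inner_part i) x"
proof -
  have far': "\<bar>real i - real j\<bar> \<ge> 7 / c"
  proof -
    have "7 / c \<le> 2 * (2 + radius) / c"
      using c by (intro divide_right_mono) (auto simp: radius_def)
    then show ?thesis using far by linarith
  qed
  have d3: "dist y (q j) \<le> 3" if "y \<in> ball x 1" for y
    using that assms dist_triangle[of y "q j" x] by (auto simp: dist_commute)
  have zero: "cutoff_grad {i..N} q y = 0" if "y \<in> ball x 1" for y
    by (rule cutoff_far(1)[OF assms(1,2) d3[OF that] far'])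
  have "kernel_integral charge_field (cutoff_grad {i..N} q) x = gauss_const * cutoff {i..N} q x"
    by (rule gauss_law[OF cutoff_has_derivative continuous_on_cutoff_grad
          bounded_support_cutoff(1) bounded_support_cutoff(2), where r=1]) (use zero in auto)
  also have "cutoff {i..N} q x = (if i \<le> j then 1 else 0)"
    by (rule cutoff_far(2)[OF assms(1,2) d3 far']) simp
  also have "kernel_integral charge_field (cutoff_grad {i..N} q) x =
      kernel_integral charge_field (outer i) x + kernel_integral charge_field (inner_part i) x"
  proof -
    have 0: "outer i y = 0" "inner_part i y = 0" if "y \<in> ball x 1" for y
      using zero[OF that] by (auto simp: outer_def inner_part_def)
    have "cutoff_grad {i..N} q y = outer i y + inner_part i y" for y
      by (simp add: outer_def inner_part_def scaleR_left_distrib[symmetric])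
    then show ?thesis
      unfolding kernel_integral_def
      using integral_add[OF
          integrable_kernel_integrand[OF continuous_outer_inner(1) continuous_on_charge_field zero_less_one 0(1) bounded_support_outer_inner(1)]
          integrable_kernel_integrand[OF continuous_outer_inner(2) continuous_on_charge_field zero_less_one 0(2) bounded_support_outer_inner(2)]]
      by (simp add: inner_add_left)
  qed
  finally show ?thesis by simp
qed

lemma outer_harmonic:
  assumes "i \<le> N"
  shows "has_harmonic_derivatives (kernel_integral charge_field (outer i))
    (\<lambda>l. kernel_integral (charge_field_d1 l) (outer i))
    (\<lambda>l m. kernel_integral (charge_field_d2 l m) (outer i)) (\<Union>j\<le>N. ball (q j) 2)"
proof (rule kernel_integral_has_harmonic_derivatives[OF continuous_outer_inner(1) bounded_support_outer_inner(1)])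
  fix x assume "x \<in> (\<Union>j\<le>N. ball (q j) 2)"
  then obtain j where j: "j \<le> N" "x \<in> ball (q j) 2" by auto
  have "outer i y = 0" if "y \<in> ball x 1" for y
    using that j assms dist_triangle[of y "q j" x]
    by (intro outer_eq_0[of i j]) (auto simp: dist_commute)
  then show "\<exists>r>0. \<forall>y\<in>ball x r. outer i y = 0"
    by (intro exI[of _ 1]) auto
qed auto

text \<open>Provides the derivative of the right-hand side of
  \<open>gauss_outer_inner\<close>.\<close>

lemma inner_harmonic:
  assumes "i \<le> N" "j \<le> N" and far: "\<bar>real i - real j\<bar> \<ge> 2 * (2 + radius) / c"
  shows "has_harmonic_derivatives (kernel_integral charge_field (inner_part i))
    (\<lambda>l. kernel_integral (charge_field_d1 l) (inner_part i))
    (\<lambda>l m. kernel_integral (charge_field_d2 l m) (inner_part i)) (ball (q j) 2)"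
proof (rule kernel_integral_has_harmonic_derivatives[OF continuous_outer_inner(2) bounded_support_outer_inner(2)])
  fix x assume x: "x \<in> ball (q j) 2"
  have "7 / c \<le> 2 * (2 + radius) / c"
    using c by (intro divide_right_mono) (auto simp: radius_def)
  then have "inner_part i y = 0" if "y \<in> ball x 1" for y
    using that x dist_triangle[of y "q j" x] far cutoff_far(1)[OF assms(1,2), of y]
    by (auto simp: dist_commute inner_part_def)
  then show "\<exists>r>0. \<forall>y\<in>ball x r. inner_part i y = 0"
    by (intro exI[of _ 1]) auto
qed auto

text \<open>\<open>gauss_outer_inner\<close> holds on the whole ball around \<open>q j\<close> with
  the same step value; differentiating it removes the constant.\<close>

lemma kernel_integral_d1_outer_eq:
  assumes "i \<le> N" "j \<le> N" "x \<in> ball (q j) 2"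
    and far: "\<bar>real i - real j\<bar> \<ge> 2 * (2 + radius) / c"
  shows "kernel_integral (charge_field_d1 l) (outer i) x = - kernel_integral (charge_field_d1 l) (inner_part i) x"
proof -
  have "((\<lambda>x. gauss_const * (if i \<le> j then 1 else 0) - kernel_integral charge_field (inner_part i) x)
     has_derivative (\<lambda>h. 0 - (\<Sum>l\<in>UNIV. h $ l *\<^sub>R kernel_integral (charge_field_d1 l) (inner_part i) x))) (at x)"
    using inner_harmonic[OF assms(1,2) far] assms(3)
    by (intro has_derivative_diff has_derivative_const) (auto simp: has_harmonic_derivatives_def)
  then have "(kernel_integral charge_field (outer i)
     has_derivative (\<lambda>h. 0 - (\<Sum>l\<in>UNIV. h $ l *\<^sub>R kernel_integral (charge_field_d1 l) (inner_part i) x))) (at x)"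
    by (rule has_derivative_transform_within_open[where s="ball (q j) 2"])
      (use assms gauss_outer_inner[OF assms(1,2) _ far] in auto)
  moreover have "(kernel_integral charge_field (outer i)
     has_derivative (\<lambda>h. (\<Sum>l\<in>UNIV. h $ l *\<^sub>R kernel_integral (charge_field_d1 l) (outer i) x))) (at x)"
    using outer_harmonic[OF assms(1)] assms(2,3) unfolding has_harmonic_derivatives_def by blast
  ultimately have "(\<lambda>h. 0 - (\<Sum>l\<in>UNIV. h $ l *\<^sub>R kernel_integral (charge_field_d1 l) (inner_part i) x))
      = (\<lambda>h. \<Sum>l\<in>UNIV. h $ l *\<^sub>R kernel_integral (charge_field_d1 l) (outer i) x)"
    by (rule has_derivative_unique)
  from fun_cong[OF this, of "axis l 1"] show ?thesis
    unfolding sum_axis_nth_scaleR by simp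
qed

end

section \<open>Dilations and linear combinations of harmonic functions\<close>

lemma has_harmonic_derivatives_dilate:
  assumes "has_harmonic_derivatives u u1 u2 S" "\<delta> \<noteq> 0"
  shows "has_harmonic_derivatives (\<lambda>x. u (x /\<^sub>R \<delta>)) (\<lambda>l x. u1 l (x /\<^sub>R \<delta>) /\<^sub>R \<delta>)
    (\<lambda>l m x. u2 l m (x /\<^sub>R \<delta>) /\<^sub>R \<delta>\<^sup>2) ((\<lambda>x. x /\<^sub>R \<delta>) -` S)"
proof -
  have S: "open S"
    and d1: "\<And>x. x \<in> S \<Longrightarrow> (u has_derivative (\<lambda>h. \<Sum>i\<in>UNIV. h $ i *\<^sub>R u1 i x)) (at x)"
    and d2: "\<And>i x. x \<in> S \<Longrightarrow> (u1 i has_derivative (\<lambda>h. \<Sum>j\<in>UNIV. h $ j *\<^sub>R u2 i j x)) (at x)"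
    and cont: "\<And>i j. continuous_on S (u2 i j)"
    and lap: "\<And>x. x \<in> S \<Longrightarrow> (\<Sum>i\<in>UNIV. u2 i i x) = 0"
    using assms(1) unfolding has_harmonic_derivatives_def by auto
  have sc: "((\<lambda>x. x /\<^sub>R \<delta>) has_derivative (\<lambda>h. h /\<^sub>R \<delta>)) (at x)" for x :: "real^'n"
    by (auto intro!: derivative_eq_intros)
  show ?thesis
    unfolding has_harmonic_derivatives_def
  proof (intro conjI allI ballI)
    show "open ((\<lambda>x. x /\<^sub>R \<delta>) -` S)"
      by (intro open_vimage S continuous_intros)
  next
    fix x assume x: "x \<in> (\<lambda>x. x /\<^sub>R \<delta>) -` S"
    then have xS: "x /\<^sub>R \<delta> \<in> S" by simp
    show "((\<lambda>x. u (x /\<^sub>R \<delta>)) has_derivative (\<lambda>h. \<Sum>i\<in>UNIV. h $ i *\<^sub>R (u1 i (x /\<^sub>R \<delta>) /\<^sub>R \<delta>))) (at x)"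
      by (rule has_derivative_eq_rhs[OF has_derivative_compose[OF sc d1[OF xS]]])
        (auto simp: fun_eq_iff mult.commute)
    show "((\<lambda>x. u1 i (x /\<^sub>R \<delta>) /\<^sub>R \<delta>) has_derivative
        (\<lambda>h. \<Sum>j\<in>UNIV. h $ j *\<^sub>R (u2 i j (x /\<^sub>R \<delta>) /\<^sub>R \<delta>\<^sup>2))) (at x)" for i
      by (rule has_derivative_eq_rhs[OF has_derivative_scaleR_right[OF has_derivative_compose[OF sc d2[OF xS]]]])
        (auto simp: fun_eq_iff scaleR_sum_right power2_eq_square mult_ac)
    show "(\<Sum>i\<in>UNIV. u2 i i (x /\<^sub>R \<delta>) /\<^sub>R \<delta>\<^sup>2) = 0"
      using lap[OF xS] by (simp add: scaleR_sum_right[symmetric])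
  next
    show "continuous_on ((\<lambda>x. x /\<^sub>R \<delta>) -` S) (\<lambda>x. u2 i j (x /\<^sub>R \<delta>) /\<^sub>R \<delta>\<^sup>2)" for i j
      by (intro continuous_intros continuous_on_compose2[OF cont]) auto
  qed
qed

lemma has_harmonic_derivatives_combination:
  fixes u :: "'k \<Rightarrow> real^'n::finite \<Rightarrow> real" and d :: "'k \<Rightarrow> 'b::real_normed_vector"
  assumes "\<And>k. k \<in> I \<Longrightarrow> has_harmonic_derivatives (u k) (u1 k) (u2 k) S" and "open S"
  shows "has_harmonic_derivatives (\<lambda>x. a + (\<Sum>k\<in>I. u k x *\<^sub>R d k)) (\<lambda>l x. \<Sum>k\<in>I. u1 k l x *\<^sub>R d k)
    (\<lambda>l m x. \<Sum>k\<in>I. u2 k l m x *\<^sub>R d k) S"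
proof -
  have d1: "\<And>k x. k \<in> I \<Longrightarrow> x \<in> S \<Longrightarrow> (u k has_derivative (\<lambda>h. \<Sum>i\<in>UNIV. h $ i *\<^sub>R u1 k i x)) (at x)"
    and d2: "\<And>k i x. k \<in> I \<Longrightarrow> x \<in> S \<Longrightarrow> (u1 k i has_derivative (\<lambda>h. \<Sum>j\<in>UNIV. h $ j *\<^sub>R u2 k i j x)) (at x)"
    and cont: "\<And>k i j. k \<in> I \<Longrightarrow> continuous_on S (u2 k i j)"
    and lap: "\<And>k x. k \<in> I \<Longrightarrow> x \<in> S \<Longrightarrow> (\<Sum>i\<in>UNIV. u2 k i i x) = 0"
    using assms unfolding has_harmonic_derivatives_def by auto
  have swap: "(\<Sum>k\<in>I. (\<Sum>i\<in>UNIV. h $ i *\<^sub>R v k i) *\<^sub>R d k) = (\<Sum>i\<in>UNIV. h $ i *\<^sub>R (\<Sum>k\<in>I. v k i *\<^sub>R d k))"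
    for h :: "real^'n" and v :: "'k \<Rightarrow> 'n \<Rightarrow> real"
    unfolding scaleR_left.sum scaleR_right.sum by (subst sum.swap) simp
  show ?thesis
    unfolding has_harmonic_derivatives_def
  proof (intro conjI allI ballI assms(2))
    fix x assume x: "x \<in> S"
    have "((\<lambda>x. a + (\<Sum>k\<in>I. u k x *\<^sub>R d k)) has_derivative
        (\<lambda>h. 0 + (\<Sum>k\<in>I. (\<Sum>i\<in>UNIV. h $ i *\<^sub>R u1 k i x) *\<^sub>R d k))) (at x)"
      by (intro has_derivative_add has_derivative_const has_derivative_sum has_derivative_scaleR_left d1 x)
    then show "((\<lambda>x. a + (\<Sum>k\<in>I. u k x *\<^sub>R d k)) has_derivative
        (\<lambda>h. \<Sum>i\<in>UNIV. h $ i *\<^sub>R (\<Sum>k\<in>I. u1 k i x *\<^sub>R d k))) (at x)"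
      unfolding swap by simp
    have "((\<lambda>x. \<Sum>k\<in>I. u1 k i x *\<^sub>R d k) has_derivative
        (\<lambda>h. \<Sum>k\<in>I. (\<Sum>j\<in>UNIV. h $ j *\<^sub>R u2 k i j x) *\<^sub>R d k)) (at x)" for i
      by (intro has_derivative_sum has_derivative_scaleR_left d2 x)
    then show "((\<lambda>x. \<Sum>k\<in>I. u1 k i x *\<^sub>R d k) has_derivative
        (\<lambda>h. \<Sum>j\<in>UNIV. h $ j *\<^sub>R (\<Sum>k\<in>I. u2 k i j x *\<^sub>R d k))) (at x)" for i
      unfolding swap by simp
    show "(\<Sum>i\<in>UNIV. \<Sum>k\<in>I. u2 k i i x *\<^sub>R d k) = 0"
      by (subst sum.swap) (simp add: scaleR_left.sum[symmetric] lap x)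
  next
    show "continuous_on S (\<lambda>x. \<Sum>k\<in>I. u2 k i j x *\<^sub>R d k)" for i j
      by (intro continuous_on_sum continuous_on_scaleR continuous_on_const cont)
  qed
qed

lemma has_harmonic_derivatives_subset:
  assumes "has_harmonic_derivatives u u1 u2 S" "open T" "T \<subseteq> S"
  shows "has_harmonic_derivatives u u1 u2 T"
  using assms(1) subsetD[OF assms(3)]
  unfolding has_harmonic_derivatives_def by (auto simp: assms(2) intro: continuous_on_subset[OF _ assms(3)])

text \<open>The constant is chosen before the chain, so it depends on c alone. The witness is the
  potential of \<open>outer i\<close> divided by \<open>gauss_const\<close>.\<close>

lemma harmonic_steps_exist:
  assumes c: "0 < c" "c \<le> 1"
  obtains C where "C \<ge> 0"
    and "\<And>q N i. separated_chain q N c \<Longrightarrow> i \<le> N \<Longrightarrow>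
      \<exists>u u1 u2. has_harmonic_derivatives u u1 u2 (\<Union>j\<le>N. ball (q j) 2) \<and>
        (\<forall>j\<le>N. \<forall>x\<in>ball (q j) 2. \<bar>u x - (if i \<le> j then 1 else 0)\<bar> \<le> C / (1 + \<bar>real i - real j\<bar>)\<^sup>2 \<and>
          (\<forall>l. \<bar>u1 l x\<bar> \<le> C / (1 + \<bar>real i - real j\<bar>)\<^sup>2))"
proof -
  define R where "R = 4 + 7 / c"
  define M where "M = 2 * (2 + R) / c"
  define V where "V = 320 * measure lborel (cball (0::real^3) 4)"
  define A where "A = V * (4 * (4 / (c / 8) ^ 3)) / gauss_const"
  define B where "B = V * (4 * (4 / (c / 4) ^ 3) * (1 + (R + 4) / c)\<^sup>2) / gauss_const"
  \<comment> \<open>B serves for |i - j| \<ge> M. Below M the bound is A, plus 1 for the step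
    itself, and (1 + M)^2 compensates for the division by (1 + |i - j|)^2.\<close>
  define C where "C = (A + 1) * (1 + M)\<^sup>2 + B"
  note kpos = gauss_const_pos
  have pos: "V \<ge> 0" "A \<ge> 0" "B \<ge> 0" "M \<ge> 0"
    using c kpos by (auto simp: V_def A_def B_def M_def R_def)
  have "C \<ge> 0" using pos by (simp add: C_def)
  moreover have "\<exists>u u1 u2. has_harmonic_derivatives u u1 u2 (\<Union>j\<le>N. ball (q j) 2) \<and>
        (\<forall>j\<le>N. \<forall>x\<in>ball (q j) 2. \<bar>u x - (if i \<le> j then 1 else 0)\<bar> \<le> C / (1 + \<bar>real i - real j\<bar>)\<^sup>2 \<and>
          (\<forall>l. \<bar>u1 l x\<bar> \<le> C / (1 + \<bar>real i - real j\<bar>)\<^sup>2))"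
    if chain: "separated_chain q N c" and i: "i \<le> N" for q N i
  proof -
    interpret separated_chain q N c by (rule chain)
    have radius: "radius = R" by (simp add: radius_def R_def)
    define u where "u x = kernel_integral charge_field (outer i) x / gauss_const" for x
    define u1 where "u1 l x = kernel_integral (charge_field_d1 l) (outer i) x / gauss_const" for l x
    define u2 where "u2 l m x = kernel_integral (charge_field_d2 l m) (outer i) x / gauss_const" for l m x
    have "open (\<Union>j\<le>N. ball (q j) 2)" by auto
    \<comment> \<open>A combination with a single term performs the division by
      \<open>gauss_const\<close>.\<close>
    then have "has_harmonic_derivatives u u1 u2 (\<Union>j\<le>N. ball (q j) 2)"
      using has_harmonic_derivatives_combination[of "{()}" "\<lambda>_. kernel_integral charge_field (outer i)"
          "\<lambda>_ l. kernel_integral (charge_field_d1 l) (outer i)"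
          "\<lambda>_ l m. kernel_integral (charge_field_d2 l m) (outer i)"
          "\<Union>j\<le>N. ball (q j) 2" 0 "\<lambda>_. 1 / gauss_const"] outer_harmonic[OF i]
      by (simp add: u_def[abs_def] u1_def[abs_def] u2_def[abs_def])
    moreover have "\<bar>u x - (if i \<le> j then 1 else 0)\<bar> \<le> C / (1 + \<bar>real i - real j\<bar>)\<^sup>2"
      "\<bar>u1 l x\<bar> \<le> C / (1 + \<bar>real i - real j\<bar>)\<^sup>2"
      if j: "j \<le> N" and x: "x \<in> ball (q j) 2" for j x l
    proof -
      define D where "D = (1 + \<bar>real i - real j\<bar>)\<^sup>2"
      have D: "D > 0" by (simp add: D_def)
      have "\<bar>u x - (if i \<le> j then 1 else 0)\<bar> \<le> C / D \<and> \<bar>u1 l x\<bar> \<le> C / D"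
      proof (cases "\<bar>real i - real j\<bar> \<ge> M")
        case True
        then have far: "\<bar>real i - real j\<bar> \<ge> 2 * (2 + radius) / c"
          by (simp add: M_def radius)
        have BC: "B / D \<le> C / D"
          using pos D by (intro divide_right_mono) (auto simp: C_def)
        have le: "\<bar>kernel_integral K (inner_part i) x\<bar> / gauss_const \<le> B / D"
          if "K = charge_field \<or> K = charge_field_d1 l" for K
          using divide_right_mono[OF kernel_integral_inner_le[OF i j x that far], of gauss_const] kpos
          by (simp add: B_def V_def D_def radius mult_ac)
        have "u x - (if i \<le> j then 1 else 0) = - kernel_integral charge_field (inner_part i) x / gauss_const"
          unfolding u_def gauss_outer_inner[OF i j x far] using kpos by (simp add: diff_divide_distrib)
        moreover have "u1 l x = - kernel_integral (charge_field_d1 l) (inner_part i) x / gauss_const"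
          using kernel_integral_d1_outer_eq[OF i j x far] by (simp add: u1_def)
        ultimately show ?thesis
          using le[of charge_field] le[of "charge_field_d1 l"] BC kpos by (simp add: abs_divide)
      next
        case False
        have le: "\<bar>kernel_integral K (outer i) x\<bar> / gauss_const \<le> A"
          if "K = charge_field \<or> K = charge_field_d1 l" for K
          using divide_right_mono[OF kernel_integral_outer_le[OF i j x that], of gauss_const] kpos
          by (simp add: A_def V_def)
        have "(A + 1) * D \<le> (A + 1) * (1 + M)\<^sup>2"
          unfolding D_def using False pos by (intro mult_left_mono power_mono) auto
        then have AC: "A + 1 \<le> C / D"
          using pos D by (simp add: C_def field_simps)
        have "\<bar>u x\<bar> \<le> A" "\<bar>u1 l x\<bar> \<le> A"
          using le[of charge_field] le[of "charge_field_d1 l"] kpos by (auto simp: u_def u1_def abs_divide)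
        then show ?thesis
          using AC by (auto simp: abs_le_iff)
      qed
      then show "\<bar>u x - (if i \<le> j then 1 else 0)\<bar> \<le> C / (1 + \<bar>real i - real j\<bar>)\<^sup>2"
        "\<bar>u1 l x\<bar> \<le> C / (1 + \<bar>real i - real j\<bar>)\<^sup>2"
        unfolding D_def by auto
    qed
    ultimately show ?thesis by blast
  qed
  ultimately show ?thesis
    by (rule that)
qed

section \<open>Chains of equidistant points on a chord-arc curve\<close>

text \<open>A greedy choice: from the current parameter go to the first one whose point is at
  distance \<delta>, and stop when the rest of the curve stays within \<delta>. Uniform continuity
  bounds the number of steps; n in the induction counts parameter lengths \<eta>.\<close>

lemma equidistant_chain_exists:
  fixes g :: "real \<Rightarrow> 'a::metric_space"
  assumes g: "continuous_on {0..1} g" and \<delta>: "\<delta> > 0"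
  obtains t :: "nat \<Rightarrow> real" and N where "\<And>k. k \<le> N \<Longrightarrow> t k \<in> {0..1}"
    and "\<And>k. k < N \<Longrightarrow> t k < t (Suc k)"
    and "\<And>k. k < N \<Longrightarrow> dist (g (t k)) (g (t (Suc k))) = \<delta>"
    and "\<And>s. s \<in> {0..1} \<Longrightarrow> \<exists>k\<le>N. dist (g s) (g (t k)) \<le> \<delta>"
proof -
  obtain \<eta> where \<eta>: "\<eta> > 0"
    "\<And>s s'. s \<in> {0..1} \<Longrightarrow> s' \<in> {0..1} \<Longrightarrow> dist s' s < \<eta> \<Longrightarrow> dist (g s') (g s) < \<delta>"
    using compact_uniformly_continuous[OF g compact_Icc] \<delta> unfolding uniformly_continuous_on_def by metis
  have chain: "\<exists>(t :: nat \<Rightarrow> real) N. t 0 = a \<and> (\<forall>k\<le>N. t k \<in> {0..1}) \<and>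
      (\<forall>k<N. t k < t (Suc k) \<and> dist (g (t k)) (g (t (Suc k))) = \<delta>) \<and>
      (\<forall>s\<in>{a..1}. \<exists>k\<le>N. dist (g s) (g (t k)) \<le> \<delta>)"
    if "a \<in> {0..1}" "1 - a \<le> real n * \<eta>" for a n
    using that
  proof (induction n arbitrary: a)
    case 0
    then have "a = 1" by simp
    then show ?case
      using \<delta> by (intro exI[of _ "\<lambda>_. 1"] exI[of _ 0]) auto
  next
    case (Suc n)
    show ?case
    proof (cases "\<forall>s\<in>{a..1}. dist (g s) (g a) \<le> \<delta>")
      case True
      then show ?thesis
        using Suc.prems by (intro exI[of _ "\<lambda>_. a"] exI[of _ 0]) auto
    next
      case False
      then obtain s0 where s0: "s0 \<in> {a..1}" "dist (g s0) (g a) > \<delta>" by force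
      define S where "S = {s \<in> {a..1}. dist (g s) (g a) = \<delta>}"
      have ga: "continuous_on {a..1} (\<lambda>s. dist (g s) (g a))"
        using Suc.prems by (intro continuous_intros continuous_on_subset[OF g]) auto
      have hit: "\<exists>s'\<in>S. s' \<le> s" if "s \<in> {a..1}" "dist (g s) (g a) \<ge> \<delta>" for s
      proof -
        have "continuous_on {a..s} (\<lambda>s. dist (g s) (g a))"
          using that by (intro continuous_on_subset[OF ga]) auto
        from IVT'[of "\<lambda>s. dist (g s) (g a)", OF _ that(2) _ this] show ?thesis
          using that \<delta> by (auto simp: S_def)
      qed
      \<comment> \<open>Compactness provides a first hitting parameter b; before it the distance to
        \<open>g a\<close> stays below \<delta>, which gives the covering property.\<close>
      have "compact S"
      proof -
        have "closed S"
          unfolding S_def by (rule continuous_closed_preimage_constant[OF ga closed_atLeastAtMost])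
        moreover have "bounded S"
          by (rule bounded_subset[of "{a..1}"]) (auto simp: S_def)
        ultimately show ?thesis
          by (simp add: compact_eq_bounded_closed)
      qed
      moreover have "S \<noteq> {}"
        using hit[of s0] s0 by auto
      ultimately obtain b where b: "b \<in> S" "\<And>s. s \<in> S \<Longrightarrow> b \<le> s"
        using compact_attains_inf[of S] by metis
      have bd: "b \<in> {a..1}" "dist (g b) (g a) = \<delta>"
        using b by (auto simp: S_def)
      \<comment> \<open>Points at distance \<delta> cannot have parameters closer than \<eta>, so
        each step uses up one unit of n.\<close>
      have "b - a \<ge> \<eta>"
        using \<eta>(2)[of a b] Suc.prems bd by (force simp: dist_real_def not_less[symmetric])
      then have "1 - b \<le> real n * \<eta>" "b \<in> {0..1}" "a < b"
        using Suc.prems bd \<eta>(1) by (auto simp: algebra_simps)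
      from Suc.IH[OF this(2,1)] obtain t :: "nat \<Rightarrow> real" and N where t: "t 0 = b" "\<And>k. k \<le> N \<Longrightarrow> t k \<in> {0..1}"
        "\<And>k. k < N \<Longrightarrow> t k < t (Suc k) \<and> dist (g (t k)) (g (t (Suc k))) = \<delta>"
        "\<And>s. s \<in> {b..1} \<Longrightarrow> \<exists>k\<le>N. dist (g s) (g (t k)) \<le> \<delta>"
        by blast
      define t' where "t' = case_nat a t"
      have t': "t' 0 = a" "\<And>k. t' (Suc k) = t k" by (simp_all add: t'_def)
      have "t' k \<in> {0..1}" if "k \<le> Suc N" for k
        using that t(2) Suc.prems by (cases k) (auto simp: t')
      moreover have "t' k < t' (Suc k) \<and> dist (g (t' k)) (g (t' (Suc k))) = \<delta>" if "k < Suc N" for k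
        using that t(1,3) bd \<open>a < b\<close> by (cases k) (auto simp: t' dist_commute)
      moreover have "\<exists>k\<le>Suc N. dist (g s) (g (t' k)) \<le> \<delta>" if "s \<in> {a..1}" for s
      proof (cases "s < b")
        case True
        then have "dist (g s) (g a) < \<delta>"
          using hit[OF that] b(2) by force
        then show ?thesis
          by (intro exI[of _ 0]) (simp add: t')
      next
        case False
        then have "s \<in> {b..1}" using that by auto
        from t(4)[OF this] obtain k where "k \<le> N" "dist (g s) (g (t k)) \<le> \<delta>"
          by blast
        then show ?thesis
          by (intro exI[of _ "Suc k"]) (simp add: t')
      qed
      ultimately show ?thesis
        using t'(1) by blast
    qed
  qed
  obtain n where "1 - 0 \<le> real n * \<eta>"
    using reals_Archimedean3[OF \<eta>(1)] by (metis less_imp_le diff_zero)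
  from chain[OF _ this] obtain t N where "\<forall>k\<le>N. t k \<in> {0..1}"
      "\<forall>k<N. t k < t (Suc k) \<and> dist (g (t k)) (g (t (Suc k))) = \<delta>"
      "\<forall>s\<in>{0..1}. \<exists>k\<le>N. dist (g s) (g (t k)) \<le> \<delta>"
    by auto
  then show ?thesis
    by (intro that[of N t]) auto
qed

lemma path_length_subpath_ge:
  fixes g :: "real \<Rightarrow> 'a::real_normed_vector"
  assumes t: "\<And>l. j \<le> l \<Longrightarrow> l < k \<Longrightarrow> t l < t (Suc l)" and "j < k"
  shows "(\<Sum>l<k - j. ennreal (dist (g (t (j + l))) (g (t (j + Suc l))))) \<le> path_length (subpath (t j) (t k) g)"
proof -
  have mono: "t l \<le> t m" if "j \<le> l" "l \<le> m" "m \<le> k" for l m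
    using that(2,3)
  proof (induction m rule: dec_induct)
    case (step m)
    then show ?case using t[of m] that(1) by force
  qed simp
  have tjk: "t j < t k"
    using t[of j] mono[of "Suc j" k] \<open>j < k\<close> by force
  \<comment> \<open>The affine inverse of the reparametrization in \<open>subpath\<close>; the chain
    becomes an inscribed polygon of the subarc.\<close>
  define s where "s l = (t (j + l) - t j) / (t k - t j)" for l
  define ts where "ts = map s [0..<Suc (k - j)]"
  have len: "length ts = Suc (k - j)" by (simp add: ts_def)
  have nth: "ts ! l = s l" if "l \<le> k - j" for l
    using that nth_map_upt[of l "Suc (k - j)" 0 s] by (simp add: ts_def)
  have "sorted ts"
    unfolding sorted_iff_nth_mono
    using tjk \<open>j < k\<close> by (auto simp: len nth s_def intro!: divide_right_mono mono)
  moreover have "set ts \<subseteq> {0..1}"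
  proof -
    have "s l \<in> {0..1}" if "l \<le> k - j" for l
      using mono[of j "j + l"] mono[of "j + l" k] that tjk \<open>j < k\<close> by (auto simp: s_def field_simps)
    then show ?thesis by (auto simp: ts_def)
  qed
  ultimately have "(\<Sum>l<length ts - 1. ennreal (dist (subpath (t j) (t k) g (ts ! l)) (subpath (t j) (t k) g (ts ! Suc l))))
      \<le> path_length (subpath (t j) (t k) g)"
    unfolding path_length_def by (intro SUP_upper) auto
  moreover have "subpath (t j) (t k) g (s l) = g (t (j + l))" for l
    using tjk by (simp add: subpath_def s_def)
  ultimately show ?thesis
    by (simp add: len nth)
qed

text \<open>From below, the chain between two of its points is a polygon of length \<delta> |j - k|
  inscribed in their subarc, whose length is at most C times the chord. From above, the triangle
  inequality suffices.\<close>

lemma chord_arc_chain: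
  fixes g :: "real \<Rightarrow> 'a::real_normed_vector"
  assumes arc: "\<And>s t. s \<in> {0..1} \<Longrightarrow> t \<in> {0..1} \<Longrightarrow> path_length (subpath s t g) \<le> ennreal (C * dist (g s) (g t))"
    and C: "C \<ge> 1" and t01: "\<And>k. k \<le> N \<Longrightarrow> t k \<in> {0..1}"
    and t: "\<And>k. k < N \<Longrightarrow> t k < t (Suc k)"
    and d: "\<And>k. k < N \<Longrightarrow> dist (g (t k)) (g (t (Suc k))) = \<delta>" and \<delta>: "\<delta> > 0"
    and jk: "j \<le> N" "k \<le> N"
  shows "\<delta> / C * \<bar>real j - real k\<bar> \<le> dist (g (t j)) (g (t k))"
    and "dist (g (t j)) (g (t k)) \<le> \<delta> * \<bar>real j - real k\<bar>"
proof -
  have lower: "\<delta> / C * (real k - real j) \<le> dist (g (t j)) (g (t k))" if "j < k" "k \<le> N" for j k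
  proof -
    have "ennreal (real (k - j) * \<delta>) = (\<Sum>l<k - j. ennreal (dist (g (t (j + l))) (g (t (j + Suc l)))))"
      using that d \<delta> by (simp add: ennreal_mult ennreal_of_nat_eq_real_of_nat)
    also have "\<dots> \<le> path_length (subpath (t j) (t k) g)"
      using that t by (intro path_length_subpath_ge) auto
    also have "\<dots> \<le> ennreal (C * dist (g (t j)) (g (t k)))"
      using that by (intro arc t01) auto
    finally have "real (k - j) * \<delta> \<le> C * dist (g (t j)) (g (t k))"
      using C by (subst (asm) ennreal_le_iff) auto
    then show ?thesis
      using C that by (simp add: field_simps of_nat_diff)
  qed
  have upper: "dist (g (t j)) (g (t k)) \<le> \<delta> * (real k - real j)" if "j \<le> k" "k \<le> N" for j k
    using that
  proof (induction k rule: dec_induct)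
    case (step m)
    have "dist (g (t j)) (g (t (Suc m))) \<le> dist (g (t j)) (g (t m)) + dist (g (t m)) (g (t (Suc m)))"
      by (rule dist_triangle)
    also have "\<dots> \<le> \<delta> * (real m - real j) + \<delta>"
      using step d[of m] by simp
    finally show ?case by (simp add: algebra_simps)
  qed simp
  show "\<delta> / C * \<bar>real j - real k\<bar> \<le> dist (g (t j)) (g (t k))"
    using lower[of j k] lower[of k j] jk by (cases j k rule: linorder_cases) (auto simp: dist_commute)
  show "dist (g (t j)) (g (t k)) \<le> \<delta> * \<bar>real j - real k\<bar>"
    using upper[of j k] upper[of k j] jk by (cases j k rule: linorder_cases) (auto simp: dist_commute)
qed

section \<open>Assembling the approximant\<close>

lemma open_tube: "open (tube \<delta> L)"
  unfolding tube_def by auto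

lemma norm_vec_le_card:
  fixes v :: "'a::real_normed_vector^'n::finite"
  assumes "\<And>i. norm (v $ i) \<le> B"
  shows "norm v \<le> real CARD('n) * B"
proof -
  have "norm v \<le> (\<Sum>i\<in>UNIV. norm (v $ i))"
    unfolding norm_vec_def by (rule L2_set_le_sum) auto
  also have "\<dots> \<le> real CARD('n) * B"
    using sum_bounded_above[of UNIV "\<lambda>i. norm (v $ i)" B] assms by simp
  finally show ?thesis .
qed

theorem theorem1:
  fixes \<omega> :: "real \<Rightarrow> real" and L :: "(real^3) set" and f :: "real^3 \<Rightarrow> complex"
  assumes "modulus_of_continuity \<omega>"
    and "\<exists>C'. \<forall>x>0. (\<integral>\<^sup>+ t\<in>{0<..<x}. ennreal (\<omega> t / t) \<partial>lborel) \<le> ennreal (C' * \<omega> x)"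
    and "\<exists>C''. \<forall>x>0. ennreal x * (\<integral>\<^sup>+ t\<in>{x<..}. ennreal (\<omega> t / t\<^sup>2) \<partial>lborel) \<le> ennreal (C'' * \<omega> x)"
    and "chord_arc_curve L"
    and "f \<in> hoelder_class \<omega> L"
  shows "\<exists>C1 C2. \<forall>\<delta>>0. \<exists>\<upsilon>. harmonic_on \<upsilon> (tube \<delta> L) \<and>
           (\<forall>M\<in>L. cmod (\<upsilon> M - f M) \<le> C1 * \<omega> \<delta>) \<and>
           (\<forall>M\<in>tube \<delta> L - tube (\<delta> / 2) L. norm (gradient \<upsilon> M) \<le> C2 * (\<omega> \<delta> / \<delta>))"
proof -
  obtain g C0 where g: "arc g" "path_image g = L"
    and C0: "\<And>s t. s \<in> {0..1} \<Longrightarrow> t \<in> {0..1} \<Longrightarrow> path_length (subpath s t g) \<le> ennreal (C0 * dist (g s) (g t))"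
    using assms(4) unfolding chord_arc_curve_def by blast
  \<comment> \<open>The maximum with 1 puts \<open>c = 1 / C\<close> into (0, 1], as
    \<open>separated_chain\<close> requires.\<close>
  define C where "C = max 1 C0"
  have C: "C \<ge> 1" by (simp add: C_def)
  have arc: "path_length (subpath s t g) \<le> ennreal (C * dist (g s) (g t))" if "s \<in> {0..1}" "t \<in> {0..1}" for s t
    by (rule order_trans[OF C0[OF that]]) (auto intro!: ennreal_leI mult_right_mono simp: C_def)
  define c where "c = 1 / C"
  have c: "0 < c" "c \<le> 1" using C by (auto simp: c_def)
  obtain A where A: "A \<ge> 0"
    and step: "\<And>q N i. separated_chain q N c \<Longrightarrow> i \<le> N \<Longrightarrow>
      \<exists>u u1 u2. has_harmonic_derivatives u u1 u2 (\<Union>j\<le>N. ball (q j) 2) \<and>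
        (\<forall>j\<le>N. \<forall>x\<in>ball (q j) 2. \<bar>u x - (if i \<le> j then 1 else 0)\<bar> \<le> A / (1 + \<bar>real i - real j\<bar>)\<^sup>2 \<and>
          (\<forall>l. \<bar>u1 l x\<bar> \<le> A / (1 + \<bar>real i - real j\<bar>)\<^sup>2))"
    using harmonic_steps_exist[OF c] by metis
  have mono: "\<And>s t. 0 \<le> s \<Longrightarrow> s \<le> t \<Longrightarrow> \<omega> s \<le> \<omega> t" and \<omega>pos: "\<And>t. t > 0 \<Longrightarrow> \<omega> t > 0" and \<omega>0: "\<omega> 0 = 0"
    using assms(1) unfolding modulus_of_continuity_def mono_on_def by auto
  obtain Cf where Cf: "\<And>x y. x \<in> L \<Longrightarrow> y \<in> L \<Longrightarrow> cmod (f y - f x) \<le> Cf * \<omega> (dist x y)"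
    using assms(5) unfolding hoelder_class_def by auto
  define B where "B = \<bar>Cf\<bar>"
  have f_close: "cmod (f y - f x) \<le> B * \<omega> \<delta>" if "x \<in> L" "y \<in> L" "dist x y \<le> \<delta>" for x y \<delta>
  proof -
    have "0 \<le> \<omega> (dist x y)" using mono[of 0 "dist x y"] \<omega>0 by simp
    then have "Cf * \<omega> (dist x y) \<le> B * \<omega> \<delta>"
      using mono[OF zero_le_dist that(3)] by (intro mult_mono) (auto simp: B_def)
    then show ?thesis using Cf[OF that(1,2)] by linarith
  qed
  \<comment> \<open>The factor 4 bounds the sum of inverse squares, the summand 1 pays for moving
    from M to a chain point, and 3 is the dimension, from \<open>norm_vec_le_card\<close>.\<close>
  have "\<exists>\<upsilon>. harmonic_on \<upsilon> (tube \<delta> L) \<and>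
           (\<forall>M\<in>L. cmod (\<upsilon> M - f M) \<le> ((4 * A + 1) * B) * \<omega> \<delta>) \<and>
           (\<forall>M\<in>tube \<delta> L - tube (\<delta> / 2) L. norm (gradient \<upsilon> M) \<le> (3 * (4 * A * B)) * (\<omega> \<delta> / \<delta>))"
    if \<delta>: "\<delta> > 0" for \<delta>
  proof -
    have "continuous_on {0..1} g"
      using g(1) by (simp add: arc_def path_def)
    then obtain t :: "nat \<Rightarrow> real" and N where t01: "\<And>k. k \<le> N \<Longrightarrow> t k \<in> {0..1}"
      and t: "\<And>k. k < N \<Longrightarrow> t k < t (Suc k)"
      and td: "\<And>k. k < N \<Longrightarrow> dist (g (t k)) (g (t (Suc k))) = \<delta>"
      and cover: "\<And>s. s \<in> {0..1} \<Longrightarrow> \<exists>k\<le>N. dist (g s) (g (t k)) \<le> \<delta>"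
      using equidistant_chain_exists[OF _ \<delta>] by metis
    define p where "p k = g (t k)" for k
    define q where "q k = p k /\<^sub>R \<delta>" for k
    have pL: "p k \<in> L" if "k \<le> N" for k
      using t01[OF that] g(2) by (auto simp: p_def path_image_def)
    have dist_scaled: "dist (x /\<^sub>R \<delta>) (y /\<^sub>R \<delta>) = dist x y / \<delta>" for x y :: "real^3"
      using \<delta> by (simp add: dist_norm scaleR_diff_right[symmetric] divide_inverse mult.commute)
    have dist_q: "dist (q j) (x /\<^sub>R \<delta>) = dist (p j) x / \<delta>" for j x
      unfolding q_def by (rule dist_scaled)
    have chain: "separated_chain q N c"
    proof
      fix j k assume jk: "j \<le> N" "k \<le> N"
      note b = chord_arc_chain[where g=g and t=t and N=N, OF arc C t01 t td \<delta> jk]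
      have dq: "dist (q j) (q k) = dist (g (t j)) (g (t k)) / \<delta>"
        unfolding q_def p_def by (rule dist_scaled)
      show "c * \<bar>real j - real k\<bar> \<le> dist (q j) (q k)"
        unfolding dq c_def using b(1) \<delta> by (simp add: field_simps)
      show "dist (q j) (q k) \<le> \<bar>real j - real k\<bar>"
        unfolding dq using b(2) \<delta> by (simp add: field_simps)
    qed (use c in auto)
    let ?U = "\<Union>j\<le>N. ball (q j) 2"
    have "\<forall>i\<in>{1..N}. \<exists>u u1 u2. has_harmonic_derivatives u u1 u2 ?U \<and>
        (\<forall>j\<le>N. \<forall>x\<in>ball (q j) 2. \<bar>u x - (if i \<le> j then 1 else 0)\<bar> \<le> A / (1 + \<bar>real i - real j\<bar>)\<^sup>2 \<and>
          (\<forall>l. \<bar>u1 l x\<bar> \<le> A / (1 + \<bar>real i - real j\<bar>)\<^sup>2))"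
      using step[OF chain] by simp
    then obtain H H1 H2 where H: "\<And>i. i \<in> {1..N} \<Longrightarrow> has_harmonic_derivatives (H i) (H1 i) (H2 i) ?U"
      and Hb: "\<And>i j x. i \<in> {1..N} \<Longrightarrow> j \<le> N \<Longrightarrow> x \<in> ball (q j) 2 \<Longrightarrow>
          \<bar>H i x - (if i \<le> j then 1 else 0)\<bar> \<le> A / (1 + \<bar>real i - real j\<bar>)\<^sup>2"
      and H1b: "\<And>i j x l. i \<in> {1..N} \<Longrightarrow> j \<le> N \<Longrightarrow> x \<in> ball (q j) 2 \<Longrightarrow>
          \<bar>H1 i l x\<bar> \<le> A / (1 + \<bar>real i - real j\<bar>)\<^sup>2"
      by metis
    define d where "d i = f (p i) - f (p (i - 1))" for i
    have d: "cmod (d i) \<le> B * \<omega> \<delta>" if "i \<in> {1..N}" for i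
      unfolding d_def using that td[of "i - 1"]
      by (intro f_close pL) (auto simp: p_def dist_commute)
    define \<upsilon> where "\<upsilon> x = f (p 0) + (\<Sum>i\<in>{1..N}. H i (x /\<^sub>R \<delta>) *\<^sub>R d i)" for x
    define \<upsilon>1 where "\<upsilon>1 l x = (\<Sum>i\<in>{1..N}. (H1 i l (x /\<^sub>R \<delta>) /\<^sub>R \<delta>) *\<^sub>R d i)" for l x
    have near: "\<exists>j\<le>N. dist M (p j) \<le> \<delta>" if "M \<in> L" for M
      using that cover g(2) by (auto simp: p_def path_image_def)
    \<comment> \<open>The radius 2 is 1 for the tube plus 1 for the distance from the curve to the
      chain, in units of \<delta>.\<close>
    have tube_near: "\<exists>j\<le>N. x /\<^sub>R \<delta> \<in> ball (q j) 2" if x: "x \<in> tube \<delta> L" for x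
    proof -
      obtain M where M: "M \<in> L" "dist M x < \<delta>"
        using x by (auto simp: tube_def)
      then obtain j where "j \<le> N" "dist M (p j) \<le> \<delta>"
        using near by blast
      then have "dist (p j) x < 2 * \<delta>"
        using M dist_triangle[of "p j" x M] by (simp add: dist_commute)
      then show ?thesis
        using \<delta> \<open>j \<le> N\<close> dist_q[of j x] by (auto simp: pos_divide_less_eq)
    qed
    have "has_harmonic_derivatives \<upsilon> \<upsilon>1
        (\<lambda>l m x. \<Sum>i\<in>{1..N}. (H2 i l m (x /\<^sub>R \<delta>) /\<^sub>R \<delta>\<^sup>2) *\<^sub>R d i) ((\<lambda>x. x /\<^sub>R \<delta>) -` ?U)"
      unfolding \<upsilon>_def[abs_def] \<upsilon>1_def[abs_def]
    proof (rule has_harmonic_derivatives_combination)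
      show "has_harmonic_derivatives (\<lambda>x. H i (x /\<^sub>R \<delta>)) (\<lambda>l x. H1 i l (x /\<^sub>R \<delta>) /\<^sub>R \<delta>)
         (\<lambda>l m x. H2 i l m (x /\<^sub>R \<delta>) /\<^sub>R \<delta>\<^sup>2) ((\<lambda>x. x /\<^sub>R \<delta>) -` ?U)" if "i \<in> {1..N}" for i
        using H[OF that] \<delta> by (intro has_harmonic_derivatives_dilate) auto
      show "open ((\<lambda>x. x /\<^sub>R \<delta>) -` ?U)"
        by (intro open_vimage continuous_intros) auto
    qed
    then have harm: "has_harmonic_derivatives \<upsilon> \<upsilon>1
        (\<lambda>l m x. \<Sum>i\<in>{1..N}. (H2 i l m (x /\<^sub>R \<delta>) /\<^sub>R \<delta>\<^sup>2) *\<^sub>R d i) (tube \<delta> L)"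
      by (rule has_harmonic_derivatives_subset) (use tube_near open_tube in \<open>fastforce+\<close>)
    \<comment> \<open>Applied with w the errors of the step functions for the values and with w
      their partial derivatives for the gradient.\<close>
    have weighted: "cmod (\<Sum>i\<in>{1..N}. w i *\<^sub>R d i) \<le> 4 * A * B * \<omega> \<delta>"
      if "\<And>i. i \<in> {1..N} \<Longrightarrow> \<bar>w i\<bar> \<le> A / (1 + \<bar>real i - real j\<bar>)\<^sup>2" for w j
    proof -
      have "cmod (\<Sum>i\<in>{1..N}. w i *\<^sub>R d i) \<le> (\<Sum>i\<in>{1..N}. A / (1 + \<bar>real i - real j\<bar>)\<^sup>2 * (B * \<omega> \<delta>))"
      proof (rule sum_norm_le)
        fix i assume i: "i \<in> {1..N}"
        show "cmod (w i *\<^sub>R d i) \<le> A / (1 + \<bar>real i - real j\<bar>)\<^sup>2 * (B * \<omega> \<delta>)"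
          unfolding norm_scaleR using that[OF i] d[OF i] A by (intro mult_mono) auto
      qed
      also have "\<dots> = A * (B * \<omega> \<delta>) * (\<Sum>i\<in>{1..N}. 1 / (1 + \<bar>real i - real j\<bar>)\<^sup>2)"
        by (simp add: sum_distrib_left mult_ac)
      also have "\<dots> \<le> A * (B * \<omega> \<delta>) * 4"
        using A \<omega>pos[OF \<delta>] by (intro mult_left_mono sum_inverse_square_distances_le) (auto simp: B_def)
      finally show ?thesis by (simp add: mult_ac)
    qed
    have "cmod (\<upsilon> M - f M) \<le> ((4 * A + 1) * B) * \<omega> \<delta>" if M: "M \<in> L" for M
    proof -
      obtain j where j: "j \<le> N" "dist M (p j) \<le> \<delta>"
        using near[OF M] by blast
      then have Mq: "M /\<^sub>R \<delta> \<in> ball (q j) 2"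
        using \<delta> dist_q[of j M] by (simp add: dist_commute pos_divide_less_eq)
      \<comment> \<open>Telescoping: exact step functions would reproduce f at \<open>p j\<close>,
        so the error consists of the step errors and of \<open>f (p j) - f M\<close>.\<close>
      have "f (p j) = f (p 0) + (\<Sum>i\<in>{1..j}. d i)"
        by (induction j) (auto simp: d_def)
      also have "(\<Sum>i\<in>{1..j}. d i) = (\<Sum>i\<in>{1..N}. (if i \<le> j then 1 else 0) *\<^sub>R d i)"
        using j(1) by (intro sum.mono_neutral_cong_left) auto
      finally have "\<upsilon> M - f M
          = (\<Sum>i\<in>{1..N}. (H i (M /\<^sub>R \<delta>) - (if i \<le> j then 1 else 0)) *\<^sub>R d i) + (f (p j) - f M)"
        by (simp add: \<upsilon>_def scaleR_diff_left sum_subtractf)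
      also have "cmod \<dots> \<le> 4 * A * B * \<omega> \<delta> + B * \<omega> \<delta>"
        by (intro norm_triangle_mono weighted[of _ j] Hb Mq j(1) f_close[OF M pL[OF j(1)] j(2)])
      finally show ?thesis by (simp add: algebra_simps)
    qed
    moreover have "norm (gradient \<upsilon> x) \<le> (3 * (4 * A * B)) * (\<omega> \<delta> / \<delta>)" if x: "x \<in> tube \<delta> L" for x
    proof -
      obtain j where j: "j \<le> N" "x /\<^sub>R \<delta> \<in> ball (q j) 2"
        using tube_near[OF x] by blast
      have "cmod (gradient \<upsilon> x $ l) \<le> 4 * A * B * \<omega> \<delta> / \<delta>" for l
      proof -
        have "gradient \<upsilon> x $ l = (\<Sum>i\<in>{1..N}. H1 i l (x /\<^sub>R \<delta>) *\<^sub>R d i) /\<^sub>R \<delta>"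
          by (simp add: has_harmonic_derivatives_imp(2)[OF harm x] \<upsilon>1_def scaleR_right.sum)
        then have "cmod (gradient \<upsilon> x $ l) = cmod (\<Sum>i\<in>{1..N}. H1 i l (x /\<^sub>R \<delta>) *\<^sub>R d i) / \<delta>"
          using \<delta> by (simp add: divide_inverse mult.commute)
        also have "\<dots> \<le> 4 * A * B * \<omega> \<delta> / \<delta>"
          using \<delta> by (intro divide_right_mono weighted[of _ j] H1b j) auto
        finally show ?thesis .
      qed
      from norm_vec_le_card[OF this] show ?thesis by simp
    qed
    ultimately show ?thesis
      using has_harmonic_derivatives_imp(1)[OF harm] by blast
  qed
  then show ?thesis by blast
qed

end
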